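(* Let $\mathbb{K}$ be an arbitrary field. For $q=(a,b,c,\alpha,\beta,\gamma)\in\mathbb{K}^6$ satisfying $\alpha\beta\gamma\neq0$, the algebra $\widehat{S}^q$ is a PHS if and only if either $a=b=c$ and $(a^3,\alpha\beta\gamma)\neq(-1,-1)$, or the following holds: $a^9=-1$, $a^3\neq-1$, $\{b,c\}=\{a^7,a^{13}\}$ and $\alpha\beta\gamma=-a^6$.
   Context: For $q=(a,b,c,\alpha,\beta,\gamma)\in\mathbb{K}^6$, $\widehat{S}^q$ is the associative unital $\mathbb{K}$-algebra given by the generators $x,y,z$ and the relations $yz-azy-\alpha xx=0$, $zx-bxz-\beta yy=0$, $xy-cyx-\gamma zz=0$, graded by $\deg x=\deg y=\deg z=1$. For a graded algebra $A$ with finite-dimensional components $A_j$, $H_A(t)=\sum_{j\ge 0}\dim_{\mathbb{K}}A_j\,t^j$ is its Hilbert series. A quadratic algebra $A$ with $3$ generators is called PHS if $H_A(t)=(1-t)^{-3}$. *)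

theory Defs
  imports
    "HOL-Library.Poly_Mapping"
    "HOL-Algebra.QuotRing"
    "HOL-Algebra.Embedded_Algebras"
    "HOL-Computational_Algebra.Formal_Power_Series"
begin

section \<open>The free algebra on three generators\<close>

text \<open>Words form a monoid under concatenation.  Multiplication of finitely supported
  functions is convolution over the additive structure of the index type, so this instance makes
  \<open>'x list \<Rightarrow>\<^sub>0 'k\<close> the free associative unital algebra on \<open>'x\<close>.\<close>

instantiation list :: (type) monoid_add
begin

definition zero_list :: "'a list" where "zero_list = []"

definition plus_list :: "'a list \<Rightarrow> 'a list \<Rightarrow> 'a list" where "plus_list = (@)"

instance
  by intro_classes (simp_all add: zero_list_def plus_list_def)

end

datatype gen3 = GX | GY | GZ

type_synonym 'k free3 = "gen3 list \<Rightarrow>\<^sub>0 'k"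

definition scal :: "'k \<Rightarrow> 'k::field free3"
  where "scal c = Poly_Mapping.single [] c"

definition var :: "gen3 \<Rightarrow> 'k::field free3"
  where "var g = Poly_Mapping.single [g] 1"

definition free_ring :: "'k::field free3 ring"
  where "free_ring = \<lparr>carrier = UNIV, monoid.mult = (*), one = 1, zero = 0, add = (+)\<rparr>"

definition hom_part :: "nat \<Rightarrow> 'k::field free3 set"
  where "hom_part j = {f. \<forall>w \<in> Poly_Mapping.keys f. length w = j}"


section \<open>Algebras given by three generators and a set of relations\<close>

text \<open>Ideals of \<^theory>\<open>HOL-Algebra.Ideal\<close> are two-sided.\<close>

definition rel_ideal :: "'k::field free3 set \<Rightarrow> 'k free3 set"
  where "rel_ideal R = genideal free_ring R"

definition pres_alg :: "'k::field free3 set \<Rightarrow> 'k free3 set ring"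
  where "pres_alg R = free_ring Quot rel_ideal R"

definition proj :: "'k::field free3 set \<Rightarrow> 'k free3 \<Rightarrow> 'k free3 set"
  where "proj R f = rel_ideal R +>\<^bsub>free_ring\<^esub> f"

text \<open>The copy of the ground field in the algebra; \<^const>\<open>ring.dim\<close> measures dimensions over a
  subfield of the ring.\<close>

definition base_field :: "'k::field free3 set \<Rightarrow> 'k free3 set set"
  where "base_field R = proj R ` range scal"

text \<open>For homogeneous relations this is the component of degree \<open>j\<close>.\<close>

definition component :: "'k::field free3 set \<Rightarrow> nat \<Rightarrow> 'k free3 set set"
  where "component R j = proj R ` hom_part j"

definition hilbert_series :: "'k::field free3 set \<Rightarrow> rat fps"
  where "hilbert_series R =
    Abs_fps (\<lambda>j. of_nat (ring.dim (pres_alg R) (base_field R) (component R j)))"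

text \<open>\<open>R\<close> is quadratic if all relations are homogeneous of degree two.\<close>

definition PHS :: "'k::field free3 set \<Rightarrow> bool"
  where "PHS R \<longleftrightarrow> R \<subseteq> hom_part 2 \<and> hilbert_series R = inverse ((1 - fps_X) ^ 3)"


section \<open>The defining relations of the generalized Sklyanin algebra\<close>

definition S_rels :: "'k::field \<Rightarrow> 'k \<Rightarrow> 'k \<Rightarrow> 'k \<Rightarrow> 'k \<Rightarrow> 'k \<Rightarrow> 'k free3 set"
  where "S_rels a b c \<alpha> \<beta> \<gamma> =
    (let x = var GX; y = var GY; z = var GZ in
     { y * z - scal a * z * y - scal \<alpha> * x * x,
       z * x - scal b * x * z - scal \<beta> * y * y,
       x * y - scal c * y * x - scal \<gamma> * z * z })"


section \<open>The dimensions are well defined\<close>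

lemma scal_add: "scal (a + b) = scal a + scal b"
  by (simp add: scal_def single_add)

lemma scal_mult: "scal (a * b) = scal a * scal b"
  by (simp add: scal_def mult_single plus_list_def)

lemma scal_0: "scal 0 = 0"
  by (simp add: scal_def)

lemma scal_1: "scal 1 = 1"
  by (simp add: scal_def zero_list_def [symmetric] flip: single_one)

lemma var_mult: "var g * var h = Poly_Mapping.single [g, h] 1"
  by (simp add: var_def mult_single plus_list_def)

lemma scal_var_mult: "scal c * var g * var h = Poly_Mapping.single [g, h] c"
  by (simp add: var_def scal_def mult_single plus_list_def)

lemma S_rels_quadratic: "S_rels a b c \<alpha> \<beta> \<gamma> \<subseteq> hom_part 2"
  by (auto simp: S_rels_def Let_def var_mult scal_var_mult hom_part_def lookup_minus
      lookup_single when_def in_keys_iff split: if_splits)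

lemma free_ring_simps [simp]:
  "carrier free_ring = UNIV" "monoid.mult free_ring = (*)" "one free_ring = 1"
  "zero free_ring = 0" "add free_ring = (+)"
  by (simp_all add: free_ring_def)

interpretation free: ring "free_ring :: 'k::field free3 ring"
  rewrites "carrier (free_ring :: 'k free3 ring) = UNIV"
    and "monoid.mult (free_ring :: 'k free3 ring) = (*)"
    and "one (free_ring :: 'k free3 ring) = 1"
    and "zero (free_ring :: 'k free3 ring) = 0"
    and "add (free_ring :: 'k free3 ring) = (+)"
proof -
  have "\<exists>y. y + x = 0" for x :: "'k free3"
    by (rule exI[of _ "- x"]) simp
  then show "ring (free_ring :: 'k free3 ring)"
    by unfold_locales (auto simp: free_ring_def Units_def algebra_simps
        intro: exI[of _ "- _"])
qed (simp_all add: free_ring_def)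

lemma rel_ideal_ideal: "ideal (rel_ideal R) (free_ring :: 'k::field free3 ring)"
  unfolding rel_ideal_def by (rule free.genideal_ideal) simp

text \<open>Elements without terms of degree less than two form an ideal.\<close>

lemma high_ideal: "ideal {f :: 'k::field free3. \<forall>w \<in> Poly_Mapping.keys f. 2 \<le> length w} free_ring"
  (is "ideal ?J _")
proof (rule idealI)
  show "ring (free_ring :: 'k free3 ring)" by (rule free.ring_axioms)
  have add: "f + g \<in> ?J" if "f \<in> ?J" "g \<in> ?J" for f g
    using that keys_add[of f g] by blast
  have neg: "- f \<in> ?J" if "f \<in> ?J" for f
    using that by simp
  have inv: "\<ominus>\<^bsub>free_ring\<^esub> f = - f" for f :: "'k free3"
    by (rule free.minus_equality) simp_all
  show "subgroup ?J (add_monoid free_ring)"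
  proof (rule subgroup.intro)
    fix f assume "f \<in> ?J"
    then have "\<ominus>\<^bsub>free_ring\<^esub> f \<in> ?J"
      unfolding inv by (rule neg)
    then show "inv\<^bsub>add_monoid free_ring\<^esub> f \<in> ?J"
      by (simp only: a_inv_def)
  next
    fix f g assume "f \<in> ?J" "g \<in> ?J"
    then have "f + g \<in> ?J"
      by (rule add)
    then show "f \<otimes>\<^bsub>add_monoid free_ring\<^esub> g \<in> ?J"
      by (simp only: monoid.simps free_ring_simps)
  qed simp_all
  fix f g :: "'k free3" assume f: "f \<in> ?J"
  have "2 \<le> length w" if w: "w \<in> Poly_Mapping.keys (g * f)" for w
  proof -
    obtain u v where "w = u + v" "v \<in> Poly_Mapping.keys f"
      using w keys_mult[of g f] by blast
    then show ?thesis using f by (auto simp: plus_list_def intro: trans_le_add2)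
  qed
  then show "g \<otimes>\<^bsub>free_ring\<^esub> f \<in> ?J" by simp
  have "2 \<le> length w" if w: "w \<in> Poly_Mapping.keys (f * g)" for w
  proof -
    obtain u v where "w = u + v" "u \<in> Poly_Mapping.keys f"
      using w keys_mult[of f g] by blast
    then show ?thesis using f by (auto simp: plus_list_def intro: trans_le_add1)
  qed
  then show "f \<otimes>\<^bsub>free_ring\<^esub> g \<in> ?J" by simp
qed

lemma rel_ideal_high:
  assumes "R \<subseteq> hom_part 2" "f \<in> rel_ideal R"
  shows "\<forall>w \<in> Poly_Mapping.keys f. 2 \<le> length w"
  using free.genideal_minimal[OF high_ideal, of R] assms
  by (fastforce simp: rel_ideal_def hom_part_def)

lemma proj_hom: "ring_hom_ring free_ring (pres_alg R) (proj R)"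
  using ideal.rcos_ring_hom_ring[OF rel_ideal_ideal, of R]
  by (simp add: pres_alg_def proj_def[abs_def])

lemma scal_subfield: "subfield (range scal) (free_ring :: 'k::field free3 ring)"
proof (rule free.subfieldI)
  have inv: "\<ominus>\<^bsub>free_ring\<^esub> f = - f" for f :: "'k free3"
    by (rule free.minus_equality) simp_all
  have "scal (- c) = - scal c" for c :: 'k
    by (simp add: scal_def single_uminus)
  then have neg: "- scal c \<in> range scal" for c :: 'k
    by (metis rangeI)
  have "subring (range scal) (free_ring :: 'k free3 ring)"
    by (rule free.subringI)
      (auto simp: inv neg simp flip: scal_add scal_mult scal_1)
  then show "subcring (range scal) (free_ring :: 'k free3 ring)"
    by (rule free.subcringI) (auto simp: mult.commute simp flip: scal_mult)
  have "\<exists>d. d * c = 1 \<and> c * d = 1" if "c \<noteq> 0" for c :: 'k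
    using that by (intro exI[of _ "inverse c"]) simp
  moreover have "scal c = scal d \<longleftrightarrow> c = d" for c d :: 'k
    by (metis scal_def lookup_single_eq)
  ultimately show "Units (free_ring\<lparr>carrier := range scal\<rparr>) = range scal - {0 :: 'k free3}"
    by (auto simp: Units_def free_ring_def simp flip: scal_0 scal_1 scal_mult)
qed

lemma base_field_subfield:
  assumes "R \<subseteq> hom_part 2"
  shows "subfield (base_field R) (pres_alg R)"
proof -
  interpret h: ring_hom_ring free_ring "pres_alg R" "proj R" by (rule proj_hom)
  interpret I: ideal "rel_ideal R" free_ring by (rule rel_ideal_ideal)
  have "1 \<notin> rel_ideal R"
    using rel_ideal_high[OF assms, of 1] by (auto simp: zero_list_def)
  then have "\<one>\<^bsub>pres_alg R\<^esub> \<noteq> \<zero>\<^bsub>pres_alg R\<^esub>"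
    using I.a_rcos_self[of 1] by (auto simp: pres_alg_def FactRing_def free_ring_def)
  then show ?thesis
    unfolding base_field_def by (rule h.img_is_subfield(2)[OF scal_subfield])
qed

lemma Span_words:
  "ring.Span free_ring (range scal) (map (\<lambda>w. Poly_Mapping.single w 1) ws)
    = {f :: 'k::field free3. Poly_Mapping.keys f \<subseteq> set ws}"
proof (induction ws)
  case Nil
  then show ?case by simp
next
  case (Cons w ws)
  have m: "scal c * Poly_Mapping.single w 1 = Poly_Mapping.single w c" for c :: 'k
    by (simp add: scal_def mult_single plus_list_def)
  have "(\<exists>c g. Poly_Mapping.keys g \<subseteq> set ws \<and> f = Poly_Mapping.single w c + g)
      \<longleftrightarrow> Poly_Mapping.keys f \<subseteq> insert w (set ws)" for f :: "'k free3"
  proof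
    assume "\<exists>c g. Poly_Mapping.keys g \<subseteq> set ws \<and> f = Poly_Mapping.single w c + g"
    then show "Poly_Mapping.keys f \<subseteq> insert w (set ws)"
      by (force simp: in_keys_iff lookup_add lookup_single when_def split: if_splits)
  next
    assume f: "Poly_Mapping.keys f \<subseteq> insert w (set ws)"
    let ?c = "Poly_Mapping.lookup f w"
    have "Poly_Mapping.keys (f - Poly_Mapping.single w ?c) \<subseteq> set ws"
      using f by (auto simp: in_keys_iff lookup_minus lookup_single when_def split: if_splits)
    then show "\<exists>c g. Poly_Mapping.keys g \<subseteq> set ws \<and> f = Poly_Mapping.single w c + g"
      by (intro exI[of _ ?c] exI[of _ "f - Poly_Mapping.single w ?c"]) simp
  qed
  then show ?case
    using Cons.IH by (auto simp: free.line_extension_mem_iff m)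
qed

lemma component_finite_dimension:
  assumes "R \<subseteq> hom_part 2"
  shows "ring.finite_dimension (pres_alg R) (base_field R) (component R j)"
proof -
  interpret h: ring_hom_ring free_ring "pres_alg R" "proj R" by (rule proj_hom)
  let ?ws = "List.n_lists j [GX, GY, GZ]"
  let ?Us = "map (\<lambda>w. Poly_Mapping.single w 1) ?ws :: 'a free3 list"
  have "set [GX, GY, GZ] = UNIV"
    using gen3.exhaust by auto
  then have "set ?ws = {w. length w = j}"
    unfolding set_n_lists by simp
  then have "hom_part j = ring.Span free_ring (range scal) ?Us"
    unfolding Span_words by (auto simp: hom_part_def)
  then have "component R j = h.S.Span (base_field R) (map (proj R) ?Us)"
    using h.Span_hom[of "range scal" ?Us] by (simp add: component_def base_field_def free_ring_def)
  moreover have "set (map (proj R) ?Us) \<subseteq> carrier (pres_alg R)"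
    using h.hom_closed by (auto simp: free_ring_def)
  ultimately show ?thesis
    using h.S.Span_finite_dimension[OF base_field_subfield[OF assms]] by simp
qed

end

theory Submission
  imports "HOL-Algebra.Algebraic_Closure_Type" Defs
begin

text \<open>
  Write \<open>F\<close> for the free algebra, \<open>V\<close> for the span of \<open>x\<close>, \<open>y\<close>, \<open>z\<close>, \<open>R\<close> for the span of the three
  relations, \<open>I\<close> for the ideal they generate and \<open>A = F / I\<close>. The claim is that the dimensions of
  the components of \<open>A\<close> are the binomial coefficients \<open>n + 2 choose 2\<close> exactly for the listed
  parameters. Both lists of parameters together are equivalent to the conjunction of two conditions
  (\<open>condition_iff\<close>): the spaces \<open>R V\<close> and \<open>V R\<close> have a nonzero common element, a twisted
  superpotential (\<open>superpotential_condition\<close>), and not both \<open>a b c = -1\<close> and \<open>\<alpha> \<beta> \<gamma> = -1\<close>.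

  Necessity is visible in degree three, where \<open>dim A\<^sub>3 = 27 - 18 + dim (R V \<inter> V R)\<close> has to be \<open>10\<close>.
  The relations are homogeneous for the grading by integers modulo three with \<open>x\<close>, \<open>y\<close>, \<open>z\<close> in degrees
  \<open>0\<close>, \<open>1\<close>, \<open>2\<close>. Hence the linear system for a common element of \<open>R V\<close> and \<open>V R\<close> splits into three
  small systems, which are solvable under one alternative of \<open>superpotential_condition\<close> each. If one
  of them is solvable and \<open>a b c = \<alpha> \<beta> \<gamma> = -1\<close>, then \<open>a = b = c\<close>, another one is solvable as well,
  and \<open>A\<^sub>3\<close> is too large.

  For sufficiency the ground field may be replaced by its algebraic closure, since the rank of a family
  of vectors does not change (\<open>dims_scalar_ext\<close>). The second condition guarantees that the matrix of
  linear forms with rows \<open>r\<^sub>i(p, _)\<close>, the relations evaluated at a point \<open>p\<close> in their first factor, has rank at least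
  two at every point, and that \<open>R\<close> contains no pure tensor. Then all point modules have components of
  dimension at most one (\<open>point_quotient\<close>). The line module \<open>A / u A\<close> of a linear form \<open>u\<close> has a
  quotient of this kind, for a point \<open>p\<close> on the line where the determinant of the matrix vanishes; the
  kernel is generated in degree one and is a quotient of another line module. Induction bounds
  \<open>dim (A / u A)\<^sub>n\<close> by \<open>n + 1\<close> (\<open>line_quotient\<close>), and therefore \<open>dim A\<^sub>n\<close> by \<open>dim A\<^sub>n\<^sub>-\<^sub>1 + n + 1\<close>.

  The upper bound also yields the lower bound. If it is attained in the degrees below \<open>n\<close>, then left
  multiplication by any linear form \<open>u \<noteq> 0\<close> is injective there (\<open>lin_regular\<close>). So the
  superpotential provides \<open>dim A\<^sub>n\<^sub>-\<^sub>3\<close> independent relations among the products of \<open>R\<close> with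
  \<open>A\<^sub>n\<^sub>-\<^sub>2\<close>, and \<open>dim A\<^sub>n \<ge> 3 dim A\<^sub>n\<^sub>-\<^sub>1 - 3 dim A\<^sub>n\<^sub>-\<^sub>2 + dim A\<^sub>n\<^sub>-\<^sub>3\<close> follows (\<open>qdim_lower_step\<close>). This is
  the recursion of the binomial coefficients.
\<close>


section \<open>Linear algebra relative to a subspace\<close>

context vector_space
begin

lemma independent_Un_of_trivial_intersection:
  assumes "finite T" "independent T" "independent B" "span T \<inter> span B \<subseteq> {0}"
  shows "independent (T \<union> B)" "T \<inter> B = {}"
proof -
  show "T \<inter> B = {}"
  proof (rule ccontr)
    assume "T \<inter> B \<noteq> {}"
    then obtain x where x: "x \<in> T" "x \<in> B" by blast
    then have "x = 0" using assms(4) span_base[of x T] span_base[of x B] by blast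
    then show False using x assms(2) dependent_zero by blast
  qed
  show "independent (T \<union> B)"
    using assms
  proof (induction T rule: finite_induct)
    case empty
    then show ?case by simp
  next
    case (insert t T)
    have T: "independent T" "t \<notin> span T"
      using insert.prems(1) insert.hyps(2) by (auto simp: independent_insert)
    have sub: "span T \<subseteq> span (insert t T)"
      by (rule span_mono) auto
    have "independent (T \<union> B)"
      using insert.IH T(1) insert.prems(2,3) sub by blast
    moreover have "t \<notin> span (T \<union> B)"
    proof
      assume "t \<in> span (T \<union> B)"
      then obtain x y where xy: "t = x + y" "x \<in> span T" "y \<in> span B"
        unfolding span_Un by blast
      have "t - x \<in> span (insert t T)"
        using sub xy(2) by (intro span_diff) (auto intro: span_base)
      then have "y = 0" using xy insert.prems(3) by auto
      then show False using xy T(2) by simp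
    qed
    ultimately show ?case by (simp add: independent_insertI)
  qed
qed

lemma finite_basis_of_bounded_subspace:
  assumes "subspace W" "W \<subseteq> span G" "finite G"
  obtains B where "B \<subseteq> W" "independent B" "span B = W" "finite B" "card B = dim W"
proof -
  obtain B where B: "B \<subseteq> W" "independent B" "W \<subseteq> span B" "card B = dim W"
    by (rule basis_exists)
  moreover have "span B = W"
    using B assms(1) by (intro span_subspace) auto
  moreover have "finite B"
    using independent_span_bound[OF assms(3) B(2)] B(1) assms(2) by auto
  ultimately show ?thesis using that by blast
qed

text \<open>A family that is independent modulo \<open>W\<close> extends to a basis of a complement of \<open>W\<close>
  in \<open>U\<close>; this is a basis of \<open>U\<close> modulo \<open>W\<close> without forming the quotient space.\<close>

lemma complement_basis_extend:
  assumes U: "subspace U" "U \<subseteq> span G" "finite G"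
    and W: "subspace W" "W \<subseteq> U"
    and T: "T \<subseteq> U" "finite T" "independent T" "span T \<inter> W \<subseteq> {0}"
  obtains S where "T \<subseteq> S" "S \<subseteq> U" "finite S" "independent S" "span S \<inter> W \<subseteq> {0}"
    "\<And>f. f \<in> U \<Longrightarrow> \<exists>s \<in> span S. f - s \<in> W" "card S + dim W = dim U"
proof -
  obtain B where B: "B \<subseteq> W" "independent B" "span B = W" "finite B" "card B = dim W"
    using finite_basis_of_bounded_subspace[of W G] W U by blast
  have TB: "independent (T \<union> B)" "T \<inter> B = {}"
    using independent_Un_of_trivial_intersection[OF T(2,3) B(2)] T(4) B(3) by auto
  have "T \<union> B \<subseteq> U" using T(1) B(1) W(2) by blast
  then obtain C where C: "T \<union> B \<subseteq> C" "C \<subseteq> U" "independent C" "U \<subseteq> span C"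
    using maximal_independent_subset_extend[OF _ TB(1)] by blast
  have finC: "finite C"
    using independent_span_bound[OF U(3) C(3)] C(2) U(2) by auto
  define S where "S = C - B"
  have CS: "C = S \<union> B" "S \<inter> B = {}" using C(1) by (auto simp: S_def)
  have "card C = dim U"
    using basis_card_eq_dim C(2,3,4) by blast
  moreover have "card C = card S + card B"
    using CS finC by (metis card_Un_disjoint finite_Un)
  ultimately have card: "card S + dim W = dim U" using B(5) by simp
  have triv: "span S \<inter> W \<subseteq> {0}"
  proof
    fix x assume x: "x \<in> span S \<inter> W"
    then have xS: "x \<in> span S" and xB: "x \<in> span B" using B(3) by auto
    have rep: "representation C x = representation S x" "representation C x = representation B x"
      using representation_extend[OF C(3), of x S] representation_extend[OF C(3), of x B] xS xB CS
      by auto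
    have "representation C x b = 0" for b
    proof (rule ccontr)
      assume "representation C x b \<noteq> 0"
      then have "b \<in> S" "b \<in> B"
        using rep representation_ne_zero by metis+
      then show False using CS by blast
    qed
    then have "x = (\<Sum>b | False. 0)"
      using sum_nonzero_representation_eq[OF C(3), of x] xS CS span_mono[of S C] by auto
    then show "x \<in> {0}" by simp
  qed
  have dec: "\<exists>s \<in> span S. f - s \<in> W" if "f \<in> U" for f
  proof -
    have "f \<in> span (S \<union> B)" using that C(4) CS by auto
    then obtain x y where "f = x + y" "x \<in> span S" "y \<in> span B"
      unfolding span_Un by blast
    then show ?thesis using B(3) by (intro bexI[of _ x]) auto
  qed
  have "independent S" using independent_mono[OF C(3)] by (simp add: S_def)
  then show ?thesis
    by (intro that[of S])
      (use C T(1) TB(2) finC triv dec card in \<open>auto simp: S_def\<close>)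
qed

text \<open>Indexing by a family instead of a set allows equal members; a family without nontrivial relation
  is injective anyway.\<close>

lemma dim_family_independent:
  assumes "finite A" "\<And>u. (\<Sum>a\<in>A. u a *s h a) = 0 \<Longrightarrow> \<forall>a\<in>A. u a = 0"
  shows "dim (span (h ` A)) = card A"
proof -
  have inj: "inj_on h A"
  proof (rule inj_onI, rule ccontr)
    fix x y assume xy: "x \<in> A" "y \<in> A" "h x = h y" "x \<noteq> y"
    let ?u = "\<lambda>a. if a = x then 1 else if a = y then -1 else 0"
    have "(\<Sum>a\<in>A. ?u a *s h a) = (\<Sum>a\<in>{x, y}. ?u a *s h a)"
      using assms(1) xy by (intro sum.mono_neutral_right) auto
    also have "\<dots> = 0" using xy by simp
    finally show False using assms(2)[of ?u] xy(1) by auto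
  qed
  have "independent (h ` A)"
  proof (rule independent_if_scalars_zero)
    show "finite (h ` A)" using assms(1) by simp
    fix f x assume f: "(\<Sum>x\<in>h ` A. f x *s x) = 0" and x: "x \<in> h ` A"
    have "(\<Sum>a\<in>A. f (h a) *s h a) = 0"
      using f by (simp add: sum.reindex[OF inj])
    then show "f x = 0" using assms(2)[of "\<lambda>a. f (h a)"] x by auto
  qed
  then show ?thesis
    using dim_eq_card_independent card_image[OF inj] by simp
qed

end


section \<open>The graded pieces of the free algebra\<close>

definition word :: "gen3 list \<Rightarrow> 'k::field free3"
  where "word w = Poly_Mapping.single w 1"

definition smul :: "'k \<Rightarrow> 'k::field free3 \<Rightarrow> 'k free3"
  where "smul c f = scal c * f"

definition lin :: "(gen3 \<Rightarrow> 'k) \<Rightarrow> 'k::field free3"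
  where "lin c = (\<Sum>i\<in>UNIV. smul (c i) (var i))"

lemma UNIV_gen3: "UNIV = {GX, GY, GZ}"
  using gen3.exhaust by auto

instance gen3 :: finite
  by standard (simp add: UNIV_gen3)

lemma sum_gen3: "(\<Sum>i\<in>UNIV. F i) = F GX + F GY + (F GZ :: 'a::comm_monoid_add)"
  by (simp add: UNIV_gen3 add_ac)

lemma all_gen3: "(\<forall>i. P i) \<longleftrightarrow> P GX \<and> P GY \<and> P GZ"
  by (metis gen3.exhaust)

lemma ex_gen3: "(\<exists>i. P i) \<longleftrightarrow> P GX \<or> P GY \<or> P GZ"
  by (metis gen3.exhaust)

lemma single_mult: "Poly_Mapping.single v c * Poly_Mapping.single w d
    = (Poly_Mapping.single (v @ w) (c * d) :: 'k::field free3)"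
  by (simp add: mult_single plus_list_def)

lemma word_mult: "word v * word w = (word (v @ w) :: 'k::field free3)"
  by (simp add: word_def single_mult)

lemma var_word: "var i = (word [i] :: 'k::field free3)"
  by (simp add: var_def word_def)

lemma word_Nil: "word [] = (1 :: 'k::field free3)"
  using scal_1[where 'a='k] by (simp add: word_def scal_def)

lemma single_word: "Poly_Mapping.single w c = smul c (word w :: 'k::field free3)"
  by (simp add: smul_def scal_def word_def single_mult)

lemma word_sum: "f = (\<Sum>w\<in>Poly_Mapping.keys f. smul (Poly_Mapping.lookup f w) (word w :: 'k::field free3))"
  by (rule poly_mapping_eqI)
    (simp add: lookup_sum lookup_single when_def in_keys_iff flip: single_word)

text \<open>Linear statements about the free algebra need only be checked on words.\<close>

lemma free_induct [case_names zero word add]: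
  assumes "P 0" "\<And>w c. P (smul c (word w :: 'k::field free3))"
    "\<And>f g. P f \<Longrightarrow> P g \<Longrightarrow> P (f + g)"
  shows "P f"
proof -
  have "P (\<Sum>w\<in>A. smul (Poly_Mapping.lookup f w) (word w))" if "finite A" for A
    using that by (induction A rule: finite_induct) (auto intro: assms)
  then show ?thesis by (subst word_sum) simp
qed

lemma scal_central: "scal c * f = f * (scal c :: 'k::field free3)"
proof (induction f rule: free_induct)
  case (word w d)
  then show ?case
    by (simp add: scal_def single_mult mult.commute flip: single_word)
qed (simp_all add: algebra_simps)

interpretation fv: vector_space "smul :: 'k::field \<Rightarrow> 'k free3 \<Rightarrow> 'k free3"
  by standard (simp_all add: smul_def algebra_simps scal_add scal_mult scal_1)

lemma smul_mult_left [simp]: "smul c f * g = smul c (f * g)"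
  by (simp add: smul_def mult.assoc)

lemma smul_mult_right [simp]: "f * smul c g = smul c (f * g)"
  by (metis mult.assoc scal_central smul_def)

lemma span_mult_left: "f \<in> fv.span S \<Longrightarrow> g * f \<in> fv.span ((*) g ` S)"
proof (induction rule: fv.span_induct_alt)
  case base
  then show ?case by (simp add: fv.span_zero)
next
  case (step c x y)
  then show ?case
    by (auto simp: distrib_left intro!: fv.span_add fv.span_scale intro: fv.span_base)
qed

lemma span_mult_right: "f \<in> fv.span S \<Longrightarrow> f * g \<in> fv.span ((\<lambda>x. x * g) ` S)"
proof (induction rule: fv.span_induct_alt)
  case base
  then show ?case by (simp add: fv.span_zero)
next
  case (step c x y)
  then show ?case
    by (auto simp: distrib_right intro!: fv.span_add fv.span_scale intro: fv.span_base)
qed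

definition words :: "nat \<Rightarrow> 'k::field free3 set"
  where "words n = word ` {w. length w = n}"

lemma card_UNIV_gen3: "card (UNIV :: gen3 set) = 3"
  by (simp add: UNIV_gen3)

lemma card_words_length: "card {w :: gen3 list. length w = n} = 3 ^ n"
  using card_lists_length_eq[of "UNIV :: gen3 set" n] by (simp add: card_UNIV_gen3)

lemma finite_words_length: "finite {w :: gen3 list. length w = n}"
  using finite_lists_length_eq[of "UNIV :: gen3 set" n] by simp

lemma finite_words [simp]: "finite (words n)"
  by (simp add: words_def finite_words_length)

lemma word_in_hom_part: "length w = n \<Longrightarrow> word w \<in> hom_part n"
  by (simp add: word_def hom_part_def)

lemma lookup_smul [simp]: "Poly_Mapping.lookup (smul c f) w = c * Poly_Mapping.lookup f w"
  by (simp add: smul_def scal_def map.rep_eq when_def flip: mult_map_scale_conv_mult zero_list_def)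

lemma hom_part_iff: "f \<in> hom_part n \<longleftrightarrow> (\<forall>w. length w \<noteq> n \<longrightarrow> Poly_Mapping.lookup f w = 0)"
  by (auto simp: hom_part_def in_keys_iff)

lemma hom_part_subspace: "fv.subspace (hom_part n)"
  by (rule fv.subspaceI) (auto simp: hom_part_iff lookup_add)

lemma hom_part_span: "hom_part n = fv.span (words n)"
proof
  show "hom_part n \<subseteq> fv.span (words n)"
  proof
    fix f assume f: "f \<in> hom_part n"
    show "f \<in> fv.span (words n)"
      by (subst word_sum, intro fv.span_sum fv.span_scale fv.span_base)
        (use f in \<open>auto simp: hom_part_def words_def\<close>)
  qed
  show "fv.span (words n) \<subseteq> hom_part n"
    by (rule fv.span_minimal[OF _ hom_part_subspace]) (auto simp: words_def word_in_hom_part)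
qed

lemma dim_hom_part: "fv.dim (hom_part n :: 'k::field free3 set) = 3 ^ n"
proof -
  have "fv.dim (fv.span (word ` {w. length w = n}) :: 'k free3 set) = card {w :: gen3 list. length w = n}"
  proof (rule fv.dim_family_independent[OF finite_words_length], rule ballI)
    fix u :: "gen3 list \<Rightarrow> 'k" and v :: "gen3 list"
    assume u: "(\<Sum>w | length w = n. smul (u w) (word w)) = 0" and v: "v \<in> {w. length w = n}"
    have "Poly_Mapping.lookup (\<Sum>w | length w = n. smul (u w) (word w)) v = u v"
      using v by (simp add: lookup_sum lookup_single when_def finite_words_length flip: single_word)
    then show "u v = 0" using u by simp
  qed
  then show ?thesis by (simp add: hom_part_span words_def card_words_length)
qed

lemma words_mult: "f \<in> words m \<Longrightarrow> g \<in> words n \<Longrightarrow> f * g \<in> words (m + n)"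
  by (auto simp: words_def word_mult)

lemma hom_part_mult:
  assumes "f \<in> hom_part m" "g \<in> hom_part n" shows "f * g \<in> hom_part (m + n)"
proof -
  have 1: "w * g \<in> hom_part (m + n)" if "w \<in> words m" for w
  proof -
    have "w * g \<in> fv.span ((*) w ` words n)"
      using assms(2) span_mult_left by (simp add: hom_part_span)
    also have "\<dots> \<subseteq> hom_part (m + n)"
      unfolding hom_part_span using that by (intro fv.span_mono) (auto intro: words_mult)
    finally show ?thesis .
  qed
  have "f * g \<in> fv.span ((\<lambda>x. x * g) ` words m)"
    using assms(1) span_mult_right by (simp add: hom_part_span)
  also have "\<dots> \<subseteq> hom_part (m + n)"
    by (rule fv.span_minimal[OF _ hom_part_subspace]) (use 1 in auto)
  finally show ?thesis .
qed

lemma var_in_hom_part: "var i \<in> hom_part 1"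
  by (simp add: var_word word_in_hom_part)

lemma lin_in_hom_part: "lin c \<in> hom_part 1"
  unfolding lin_def
  by (intro fv.subspace_sum[OF hom_part_subspace] fv.subspace_scale[OF hom_part_subspace] var_in_hom_part)

lemma lin_mult_hom_part: "f \<in> hom_part n \<Longrightarrow> lin c * f \<in> hom_part (Suc n)"
  using hom_part_mult[OF lin_in_hom_part] by force

lemma var_mult_hom_part: "f \<in> hom_part n \<Longrightarrow> var i * f \<in> hom_part (Suc n)"
  using hom_part_mult[OF var_in_hom_part] by force

lemma hom_part_SucE:
  assumes "f \<in> hom_part (Suc n)"
  obtains g where "\<And>i. g i \<in> hom_part n" "f = (\<Sum>i\<in>UNIV. var i * g i)"
proof -
  have "\<exists>g. (\<forall>i. g i \<in> hom_part n) \<and> f = (\<Sum>i\<in>UNIV. var i * g i)"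
    using assms unfolding hom_part_span[of "Suc n"]
  proof (induction rule: fv.span_induct_alt)
    case base
    show ?case by (rule exI[of _ "\<lambda>_. 0"]) (simp add: fv.subspace_0[OF hom_part_subspace])
  next
    case (step c x y)
    then obtain g where g: "\<And>i. g i \<in> hom_part n" "y = (\<Sum>i\<in>UNIV. var i * g i)" by blast
    obtain j w where w: "length w = n" "x = word (j # w)"
      using step(1) by (auto simp: words_def length_Suc_conv)
    let ?g = "\<lambda>i. (if i = j then smul c (word w) else 0) + g i"
    have "\<forall>i. ?g i \<in> hom_part n"
      using g(1) w(1)
      by (auto intro!: fv.subspace_add[OF hom_part_subspace] fv.subspace_scale[OF hom_part_subspace]
          word_in_hom_part)
    moreover have "smul c x + y = (\<Sum>i\<in>UNIV. var i * ?g i)"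
      by (cases j) (simp_all add: g(2) w(2) sum_gen3 algebra_simps var_word word_mult)
    ultimately show ?case by (intro exI[of _ ?g] conjI)
  qed
  then show ?thesis using that by blast
qed


section \<open>Graded pieces of a quadratic ideal\<close>

lemma rel_ideal_closed:
  shows rel_ideal_zero: "0 \<in> rel_ideal R"
    and rel_ideal_add: "f \<in> rel_ideal R \<Longrightarrow> g \<in> rel_ideal R \<Longrightarrow> f + g \<in> rel_ideal R"
    and rel_ideal_mult_left: "f \<in> rel_ideal R \<Longrightarrow> h * f \<in> rel_ideal R"
    and rel_ideal_mult_right: "f \<in> rel_ideal R \<Longrightarrow> f * h \<in> rel_ideal (R :: 'k::field free3 set)"
proof -
  interpret ideal "rel_ideal R" free_ring by (rule rel_ideal_ideal)
  show "0 \<in> rel_ideal R" using additive_subgroup.zero_closed[OF additive_subgroup_axioms] by simp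
  show "f + g \<in> rel_ideal R" if "f \<in> rel_ideal R" "g \<in> rel_ideal R"
    using a_closed[OF that] by simp
  show "h * f \<in> rel_ideal R" if "f \<in> rel_ideal R" using I_l_closed[OF that, of h] by simp
  show "f * h \<in> rel_ideal R" if "f \<in> rel_ideal R" using I_r_closed[OF that, of h] by simp
qed

lemma rel_ideal_subspace: "fv.subspace (rel_ideal R)"
  by (rule fv.subspaceI) (auto simp: rel_ideal_zero rel_ideal_add smul_def rel_ideal_mult_left)

lemma rel_ideal_superset: "R \<subseteq> rel_ideal R"
  unfolding rel_ideal_def using free.genideal_self[of R] by simp

text \<open>Every element is a combination of words, so a subspace stable under multiplication by single
  variables is an ideal.\<close>

lemma rel_ideal_minimal:
  assumes J: "fv.subspace J" "R \<subseteq> J"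
    and mult: "\<And>i f. f \<in> J \<Longrightarrow> var i * f \<in> J" "\<And>i f. f \<in> J \<Longrightarrow> f * var i \<in> J"
  shows "rel_ideal R \<subseteq> (J :: 'k::field free3 set)"
proof -
  have wl: "word w * f \<in> J" if "f \<in> J" for w f
    using that
  proof (induction w)
    case (Cons i w)
    then have "var i * (word w * f) \<in> J" by (intro mult)
    then show ?case by (simp add: var_word word_mult flip: mult.assoc)
  qed (simp add: word_Nil)
  have wr: "f * word w \<in> J" if "f \<in> J" for w f
    using that
  proof (induction w arbitrary: f)
    case (Cons i w)
    then have "(f * var i) * word w \<in> J" using mult by blast
    then show ?case by (simp add: var_word word_mult mult.assoc)
  qed (simp add: word_Nil)
  have l: "h * f \<in> J" if "f \<in> J" for h f
    by (induction h rule: free_induct)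
      (use that wl J(1) in \<open>auto simp: distrib_right intro: fv.subspace_0 fv.subspace_add fv.subspace_scale\<close>)
  have r: "f * h \<in> J" if "f \<in> J" for h f
    by (induction h rule: free_induct)
      (use that wr J(1) in \<open>auto simp: distrib_left intro: fv.subspace_0 fv.subspace_add fv.subspace_scale\<close>)
  have inv: "\<ominus>\<^bsub>free_ring\<^esub> f = - f" for f :: "'k free3"
    by (rule free.minus_equality) simp_all
  have neg: "\<ominus>\<^bsub>free_ring\<^esub> f \<in> J" if "f \<in> J" for f
    unfolding inv using that fv.subspace_neg[OF J(1)] by blast
  have "subgroup J (add_monoid free_ring)"
  proof (rule subgroup.intro)
    fix f assume "f \<in> J"
    from neg[OF this] show "inv\<^bsub>add_monoid free_ring\<^esub> f \<in> J" by (simp only: a_inv_def)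
  qed (use fv.subspace_add[OF J(1)] fv.subspace_0[OF J(1)] in auto)
  then have "ideal J free_ring"
    by (intro idealI free.ring_axioms) (auto intro: l r)
  then show ?thesis
    unfolding rel_ideal_def using J(2) by (rule free.genideal_minimal)
qed

definition hcomp :: "nat \<Rightarrow> 'k::field free3 \<Rightarrow> 'k free3"
  where "hcomp n f = Poly_Mapping.mapp (\<lambda>w c. c when length w = n) f"

lemma lookup_hcomp: "Poly_Mapping.lookup (hcomp n f) w = (Poly_Mapping.lookup f w when length w = n)"
  by (simp add: hcomp_def lookup_mapp when_def in_keys_iff)

lemma hcomp_add: "hcomp n (f + g) = hcomp n f + hcomp n g"
  by (rule poly_mapping_eqI) (simp add: lookup_hcomp lookup_add when_def)

lemma hcomp_smul: "hcomp n (smul c f) = smul c (hcomp n f)"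
  by (rule poly_mapping_eqI) (simp add: lookup_hcomp when_def)

lemma hcomp_zero: "hcomp n 0 = 0"
  by (rule poly_mapping_eqI) (simp add: lookup_hcomp when_def)

lemma hcomp_word: "hcomp n (word w) = (if length w = n then word w else 0)"
  by (rule poly_mapping_eqI) (simp add: lookup_hcomp word_def lookup_single when_def)

lemma hcomp_hom_part: "f \<in> hom_part m \<Longrightarrow> hcomp n f = (if m = n then f else 0)"
  by (rule poly_mapping_eqI) (auto simp: lookup_hcomp hom_part_iff when_def)

lemma hcomp_mult_var_0: "hcomp 0 (var i * f) = 0" "hcomp 0 (f * var i) = 0"
proof (induction f rule: free_induct)
  case (word w c)
  {case 1 show ?case by (simp add: hcomp_smul var_word word_mult hcomp_word)}
  {case 2 show ?case by (simp add: hcomp_smul var_word word_mult hcomp_word)}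
qed (simp_all add: hcomp_zero hcomp_add distrib_left distrib_right)

lemma hcomp_mult_var_Suc:
  shows "hcomp (Suc n) (var i * f) = var i * hcomp n f"
    and "hcomp (Suc n) (f * var i) = hcomp n f * var i"
proof (induction f rule: free_induct)
  case (word w c)
  {case 1 show ?case by (simp add: hcomp_smul var_word word_mult hcomp_word)}
  {case 2 show ?case by (simp add: hcomp_smul var_word word_mult hcomp_word)}
qed (simp_all add: hcomp_zero hcomp_add distrib_left distrib_right)

lemmas hcomp_var_mult = hcomp_mult_var_0 hcomp_mult_var_Suc

text \<open>Spanning sets of the graded pieces \<open>I\<^sub>n\<close> of the ideal. Splitting off the first letter gives
  \<open>I\<^sub>n\<^sub>+\<^sub>2 = V I\<^sub>n\<^sub>+\<^sub>1 + R F\<^sub>n\<close>, the form in which dimensions can be counted.\<close>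

fun relation_multiples :: "(gen3 \<Rightarrow> 'k::field free3) \<Rightarrow> nat \<Rightarrow> 'k free3 set" where
  "relation_multiples r 0 = {}"
| "relation_multiples r (Suc 0) = {}"
| "relation_multiples r (Suc (Suc n)) =
    (\<Union>i. (*) (var i) ` relation_multiples r (Suc n)) \<union> (\<Union>i. (*) (r i) ` words n)"

lemma finite_relation_multiples [simp]: "finite (relation_multiples r n)"
  by (induction n rule: induct_nat_012) simp_all

lemma relation_multiples_mult_left:
  "g \<in> relation_multiples r n \<Longrightarrow> var i * g \<in> relation_multiples r (Suc n)"
  by (cases n) auto

lemma relation_multiples_mult_right:
  "g \<in> relation_multiples r n \<Longrightarrow> g * var i \<in> relation_multiples r (Suc n)"
proof (induction n arbitrary: g rule: induct_nat_012)
  case (ge2 n)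
  then consider j h where "h \<in> relation_multiples r (Suc n)" "g = var j * h"
    | j w where "w \<in> words n" "g = r j * w" by auto
  then show ?case
  proof cases
    case 1
    have "h * var i \<in> relation_multiples r (Suc (Suc n))" by (rule ge2.IH(2)[OF 1(1)])
    then have "var j * (h * var i) \<in> relation_multiples r (Suc (Suc (Suc n)))"
      by (rule relation_multiples_mult_left)
    then show ?thesis unfolding 1(2) mult.assoc .
  next
    case 2
    have "w * var i \<in> words (n + 1)"
      by (rule words_mult[OF 2(1)]) (simp add: words_def var_word)
    then have "w * var i \<in> words (Suc n)" by simp
    then have "r j * (w * var i) \<in> (\<Union>i. (*) (r i) ` words (Suc n))" by blast
    then show ?thesis unfolding 2(2) mult.assoc relation_multiples.simps(3) by (rule UnI2)
  qed
qed simp_all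

locale quadratic_relations =
  fixes r :: "gen3 \<Rightarrow> 'k::field free3"
  assumes quadratic: "r i \<in> hom_part 2"
begin

definition I :: "nat \<Rightarrow> 'k free3 set"
  where "I n = rel_ideal (range r) \<inter> hom_part n"

lemma I_subspace: "fv.subspace (I n)"
  unfolding I_def by (intro fv.subspace_inter rel_ideal_subspace hom_part_subspace)

lemma I_subset: "I n \<subseteq> hom_part n"
  by (simp add: I_def)

lemma rel_in_ideal: "r i \<in> rel_ideal (range r)"
  by (rule subsetD[OF rel_ideal_superset rangeI])

lemma I_mult_left: "f \<in> I n \<Longrightarrow> var i * f \<in> I (Suc n)"
  by (simp add: I_def rel_ideal_mult_left var_mult_hom_part)

lemma I_lin_mult: "f \<in> I n \<Longrightarrow> lin c * f \<in> I (Suc n)"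
  by (simp add: I_def rel_ideal_mult_left lin_mult_hom_part)

lemma I_rel_mult: "f \<in> hom_part n \<Longrightarrow> r i * f \<in> I (Suc (Suc n))"
  using hom_part_mult[OF quadratic, of f n i] by (simp add: I_def rel_in_ideal rel_ideal_mult_right)

lemma relation_multiples_subset: "relation_multiples r n \<subseteq> I n"
  by (induction n rule: induct_nat_012)
     (fastforce intro: I_mult_left I_rel_mult word_in_hom_part simp: words_def)+

text \<open>Since the relations are homogeneous, the elements whose homogeneous components lie in the
  spans of the multiples of the relations form an ideal.\<close>

lemma hcomp_rel_ideal_span:
  assumes "f \<in> rel_ideal (range r)"
  shows "hcomp n f \<in> fv.span (relation_multiples r n)"
proof -
  define J where "J = {f. \<forall>n. hcomp n f \<in> fv.span (relation_multiples r n)}"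
  have "rel_ideal (range r) \<subseteq> J"
  proof (rule rel_ideal_minimal)
    show "fv.subspace J"
      by (rule fv.subspaceI)
        (auto simp: J_def hcomp_zero hcomp_add hcomp_smul fv.span_zero fv.span_add fv.span_scale)
    have "r i \<in> relation_multiples r 2" for i
      by (auto simp: numeral_2_eq_2 words_def word_Nil)
    then have "r i \<in> J" for i
      by (auto simp: J_def hcomp_hom_part[OF quadratic] fv.span_zero fv.span_base)
    then show "range r \<subseteq> J" by blast
    fix i f assume "f \<in> J"
    then have f: "hcomp n f \<in> fv.span (relation_multiples r n)" for n by (simp add: J_def)
    have "var i * hcomp n f \<in> fv.span (relation_multiples r (Suc n))" for n
      by (rule subsetD[OF fv.span_mono span_mult_left[OF f]]) (auto intro: relation_multiples_mult_left)
    then have "hcomp n (var i * f) \<in> fv.span (relation_multiples r n)" for n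
      by (cases n) (simp_all add: hcomp_var_mult fv.span_zero)
    then show "var i * f \<in> J" by (simp add: J_def)
    have "hcomp n f * var i \<in> fv.span (relation_multiples r (Suc n))" for n
      by (rule subsetD[OF fv.span_mono span_mult_right[OF f]]) (auto intro: relation_multiples_mult_right)
    then have "hcomp n (f * var i) \<in> fv.span (relation_multiples r n)" for n
      by (cases n) (simp_all add: hcomp_var_mult fv.span_zero)
    then show "f * var i \<in> J" by (simp add: J_def)
  qed
  then show ?thesis using assms by (auto simp: J_def)
qed

lemma span_relation_multiples_subset: "fv.span (relation_multiples r n) \<subseteq> I n"
  by (rule fv.span_minimal[OF relation_multiples_subset I_subspace])

lemma hcomp_rel_ideal: "f \<in> rel_ideal (range r) \<Longrightarrow> hcomp n f \<in> I n"
  using hcomp_rel_ideal_span span_relation_multiples_subset by blast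

lemma I_span: "I n = fv.span (relation_multiples r n)"
proof
  show "I n \<subseteq> fv.span (relation_multiples r n)"
  proof
    fix f assume "f \<in> I n"
    then have "f \<in> rel_ideal (range r)" "hcomp n f = f" by (auto simp: I_def hcomp_hom_part)
    then show "f \<in> fv.span (relation_multiples r n)" using hcomp_rel_ideal_span[of f n] by simp
  qed
qed (rule span_relation_multiples_subset)


section \<open>Dimensions of the graded pieces\<close>

text \<open>The dimension of the component of degree \<open>n\<close> of the quotient algebra, taken as a codimension so
  that all linear algebra can be done with subspaces of the free algebra.\<close>

definition qdim :: "nat \<Rightarrow> nat"
  where "qdim n = 3 ^ n - fv.dim (I n)"

lemma basis_mod_I:
  assumes "T \<subseteq> hom_part n" "finite T" "fv.independent T" "fv.span T \<inter> I n \<subseteq> {0}"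
  obtains S where "T \<subseteq> S" "S \<subseteq> hom_part n" "finite S" "fv.independent S" "fv.span S \<inter> I n \<subseteq> {0}"
    "\<And>f. f \<in> hom_part n \<Longrightarrow> \<exists>s \<in> fv.span S. f - s \<in> I n" "card S = qdim n"
    "qdim n + fv.dim (I n) = 3 ^ n"
proof -
  obtain S where S: "T \<subseteq> S" "S \<subseteq> hom_part n" "finite S" "fv.independent S" "fv.span S \<inter> I n \<subseteq> {0}"
    "\<And>f. f \<in> hom_part n \<Longrightarrow> \<exists>s \<in> fv.span S. f - s \<in> I n"
    and card: "card S + fv.dim (I n) = fv.dim (hom_part n :: 'k free3 set)"
    by (rule fv.complement_basis_extend[OF hom_part_subspace eq_refl[OF hom_part_span] finite_words
        I_subspace I_subset assms]) blast
  have "card S = qdim n" "qdim n + fv.dim (I n) = 3 ^ n"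
    using card by (simp_all add: qdim_def dim_hom_part)
  with S show ?thesis by (rule that)
qed

lemma qdim_eq: "qdim n + fv.dim (I n) = 3 ^ n"
  by (rule basis_mod_I[of "{}" n]) (auto simp: fv.independent_empty)

lemma qdim_le_card:
  assumes S: "finite S" "\<And>f. f \<in> hom_part n \<Longrightarrow> \<exists>s \<in> fv.span S. f - s \<in> rel_ideal (range r)"
    and sub: "S \<subseteq> hom_part n"
  shows "qdim n \<le> card S"
proof -
  obtain B where B: "fv.span B = I n" "finite B" "card B = fv.dim (I n)"
    using fv.finite_basis_of_bounded_subspace[OF I_subspace, of n "words n"] I_subset
    by (metis finite_words hom_part_span)
  have "hom_part n \<subseteq> fv.span (S \<union> B)"
  proof
    fix f :: "'k free3" assume f: "f \<in> hom_part n"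
    then obtain s where s: "s \<in> fv.span S" "f - s \<in> rel_ideal (range r)" using S(2) by blast
    have "s \<in> hom_part n"
      using s(1) fv.span_minimal[OF sub hom_part_subspace] by blast
    then have "f - s \<in> fv.span B"
      using f s(2) fv.subspace_diff[OF hom_part_subspace] by (simp add: B(1) I_def)
    then have "s + (f - s) \<in> fv.span (S \<union> B)"
      using s(1) unfolding fv.span_Un by blast
    then show "f \<in> fv.span (S \<union> B)" by simp
  qed
  then have "fv.dim (hom_part n :: 'k free3 set) \<le> card (S \<union> B)"
    using S(1) B(2) by (intro fv.dim_le_card) auto
  also have "\<dots> \<le> card S + fv.dim (I n)"
    using card_Un_le[of S B] B(3) by simp
  finally show ?thesis using qdim_eq[of n] by (simp add: dim_hom_part)
qed

text \<open>The cosets of a basis modulo \<open>I n\<close> form a basis of the component over the copy of the ground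
  field in the quotient ring.\<close>

lemma dim_component: "ring.dim (pres_alg (range r)) (base_field (range r)) (component (range r) n) = qdim n"
proof -
  have R: "range r \<subseteq> hom_part 2" using quadratic by blast
  interpret h: ring_hom_ring free_ring "pres_alg (range r)" "proj (range r)" by (rule proj_hom)
  let ?J = "rel_ideal (range r)" and ?p = "proj (range r)" and ?K = "base_field (range r)"
  have inv: "\<ominus>\<^bsub>free_ring\<^esub> f = - f" for f :: "'k free3"
    by (rule free.minus_equality) simp_all
  have ker: "?p f = ?p g \<longleftrightarrow> f - g \<in> ?J" for f g
    using free.quotient_eq_iff_same_a_r_cos[OF rel_ideal_ideal, of f g "range r"]
    by (simp add: proj_def a_minus_def inv)
  have Span: "free.Span (range scal) Us = fv.span (set Us)" for Us :: "'k free3 list"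
  proof (induction Us)
    case (Cons u Us)
    have "(\<exists>v \<in> E. f = x + v) \<longleftrightarrow> f - x \<in> E" for f x :: "'k free3" and E
      by (auto intro: bexI[of _ "f - x"])
    then show ?case
      by (simp add: set_eq_iff Cons.IH[simplified] free.line_extension_mem_iff fv.span_breakdown_eq flip: smul_def)
  qed (simp add: fv.span_empty)
  have SpanS: "h.S.Span ?K (map ?p Us) = ?p ` fv.span (set Us)" for Us
    using h.Span_hom[of "range scal" Us] by (simp add: base_field_def Span[simplified])
  obtain S where S: "S \<subseteq> hom_part n" "finite S" "fv.independent S" "fv.span S \<inter> I n \<subseteq> {0}"
    "\<And>f. f \<in> hom_part n \<Longrightarrow> \<exists>s \<in> fv.span S. f - s \<in> I n" "card S = qdim n"
    by (rule basis_mod_I[of "{}" n]) (auto simp: fv.independent_empty)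
  obtain Us where Us: "set Us = S" "distinct Us"
    using finite_distinct_list[OF S(2)] by blast
  have span_sub: "fv.span S \<subseteq> hom_part n" by (rule fv.span_minimal[OF S(1) hom_part_subspace])
  have "h.S.independent ?K (map ?p Vs)" if "set Vs \<subseteq> S" "distinct Vs" for Vs
    using that
  proof (induction Vs)
    case (Cons v Vs)
    have "?p v \<notin> h.S.Span ?K (map ?p Vs)"
    proof
      assume "?p v \<in> h.S.Span ?K (map ?p Vs)"
      then have "?p v \<in> ?p ` fv.span (set Vs)" unfolding SpanS .
      then obtain s where s: "s \<in> fv.span (set Vs)" "v - s \<in> ?J"
        using ker by blast
      have sS: "s \<in> fv.span S" using s(1) fv.span_mono[of "set Vs" S] Cons.prems by auto
      then have "v - s \<in> fv.span S" using Cons.prems by (auto intro: fv.span_diff fv.span_base)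
      then have "v - s = 0" using s(2) span_sub S(4) by (auto simp: I_def)
      then have "v \<in> fv.span (S - {v})"
        using s(1) fv.span_mono[of "set Vs" "S - {v}"] Cons.prems by auto
      then show False using S(3) Cons.prems by (auto simp: fv.dependent_def)
    qed
    then show ?case
      using Cons h.hom_closed[of v] by (auto intro!: h.S.independent.li_Cons)
  qed (simp add: h.S.independent.li_Nil)
  then have "h.S.independent ?K (map ?p Us)" using Us by blast
  then have "h.S.dimension (length (map ?p Us)) ?K (h.S.Span ?K (map ?p Us))"
    by (rule h.S.dimension_independent)
  moreover have "length (map ?p Us) = qdim n"
    using Us S(6) distinct_card by fastforce
  ultimately have "h.S.dimension (qdim n) ?K (?p ` fv.span S)"
    unfolding SpanS Us(1) by metis
  moreover have "?p ` fv.span S = component (range r) n"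
    unfolding component_def
  proof
    show "?p ` fv.span S \<subseteq> ?p ` hom_part n" using span_sub by (rule image_mono)
    show "?p ` hom_part n \<subseteq> ?p ` fv.span S"
    proof
      fix y assume "y \<in> ?p ` hom_part n"
      then obtain f where f: "f \<in> hom_part n" "y = ?p f" by blast
      then obtain s where "s \<in> fv.span S" "f - s \<in> I n" using S(5) by blast
      then show "y \<in> ?p ` fv.span S" using f(2) ker[of f s] by (auto simp: I_def)
    qed
  qed
  ultimately show ?thesis
    using h.S.dimI[OF base_field_subfield[OF R]] by (simp add: over_def)
qed

end

lemma PHS_iff_dims:
  assumes "quadratic_relations r"
  shows "PHS (range r) \<longleftrightarrow> (\<forall>n. quadratic_relations.qdim r n = (n + 2) choose 2)"
proof -
  interpret quadratic_relations r by fact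
  have "(3 + k - 1) choose k = (k + 2) choose 2" for k :: nat
    using binomial_symmetric[of k "k + 2"] by (simp add: add.commute)
  then have "inverse ((1 - fps_X) ^ 3) = Abs_fps (\<lambda>k. of_nat ((k + 2) choose 2) :: rat)"
    using one_minus_const_fps_X_neg_power'[of 3 "1::rat"] by simp
  moreover have "range r \<subseteq> hom_part 2" using quadratic by blast
  ultimately show ?thesis
    by (simp add: PHS_def hilbert_series_def dim_component fps_eq_iff)
qed


section \<open>Linear forms in three variables\<close>

definition dot :: "(gen3 \<Rightarrow> 'k::field) \<Rightarrow> (gen3 \<Rightarrow> 'k) \<Rightarrow> 'k"
  where "dot u p = (\<Sum>i\<in>UNIV. u i * p i)"

definition cross :: "(gen3 \<Rightarrow> 'k::field) \<Rightarrow> (gen3 \<Rightarrow> 'k) \<Rightarrow> gen3 \<Rightarrow> 'k"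
  where "cross u v = (\<lambda>k. case k of
    GX \<Rightarrow> u GY * v GZ - u GZ * v GY
  | GY \<Rightarrow> u GZ * v GX - u GX * v GZ
  | GZ \<Rightarrow> u GX * v GY - u GY * v GX)"

lemma solve_linear: "p \<noteq> 0 \<Longrightarrow> x + c * p = 0 \<Longrightarrow> c = - x / (p :: 'k::field)"
  by (metis add.commute eq_neg_iff_add_eq_0 nonzero_eq_divide_eq)

lemma plane_coordinates:
  fixes p1 :: "'k::field"
  assumes "p3 \<noteq> 0" "u1 \<noteq> 0 \<or> u2 \<noteq> 0 \<or> u3 \<noteq> 0" "u1 * p1 + u2 * p2 + u3 * p3 = 0"
  shows "\<exists>v1 v2 v3. \<forall>c1 c2 c3. c1 * p1 + c2 * p2 + c3 * p3 = 0 \<longrightarrow>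
    (\<exists>g h. c1 = g * u1 + h * v1 \<and> c2 = g * u2 + h * v2 \<and> c3 = g * u3 + h * v3)"
proof -
  have u3: "u3 = - (u1 * p1 + u2 * p2) / p3"
    by (rule solve_linear[OF assms(1,3)])
  \<comment> \<open>The second basis vector must be orthogonal to \<open>p\<close> and not a multiple of \<open>u\<close>.\<close>
  then consider "u1 \<noteq> 0" | "u1 = 0" "u2 \<noteq> 0" using assms(2) by auto
  then show ?thesis
  proof cases
    case 1
    show ?thesis
    proof (rule exI[of _ 0], rule exI[of _ p3], rule exI[of _ "- p2"], intro allI impI)
      fix c1 c2 c3 assume c: "c1 * p1 + c2 * p2 + c3 * p3 = 0"
      have c3: "c3 = - (c1 * p1 + c2 * p2) / p3"
        by (rule solve_linear[OF assms(1) c])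
      show "\<exists>g h. c1 = g * u1 + h * 0 \<and> c2 = g * u2 + h * p3 \<and> c3 = g * u3 + h * - p2"
        by (rule exI[of _ "c1 / u1"], rule exI[of _ "(c2 - c1 / u1 * u2) / p3"])
          (use 1 assms(1) in \<open>simp add: c3 u3 field_simps\<close>)
    qed
  next
    case 2
    show ?thesis
    proof (rule exI[of _ p3], rule exI[of _ 0], rule exI[of _ "- p1"], intro allI impI)
      fix c1 c2 c3 assume c: "c1 * p1 + c2 * p2 + c3 * p3 = 0"
      have c3: "c3 = - (c1 * p1 + c2 * p2) / p3"
        by (rule solve_linear[OF assms(1) c])
      show "\<exists>g h. c1 = g * u1 + h * p3 \<and> c2 = g * u2 + h * 0 \<and> c3 = g * u3 + h * - p1"
        by (rule exI[of _ "c2 / u2"], rule exI[of _ "c1 / p3"])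
          (use 2 assms(1) in \<open>simp add: c3 u3 field_simps\<close>)
    qed
  qed
qed

text \<open>The linear forms vanishing at a point form a plane, so one further form \<open>v\<close> completes \<open>u\<close> to a
  basis of it.\<close>

lemma vanishing_forms_spanned:
  assumes p: "p j \<noteq> 0" and u: "u i \<noteq> 0" "dot u p = 0"
  shows "\<exists>v. \<forall>c. dot c p = 0 \<longrightarrow> (\<exists>g h. \<forall>j. c j = g * u j + h * v j)"
proof -
  have nz: "u GX \<noteq> 0 \<or> u GY \<noteq> 0 \<or> u GZ \<noteq> 0" using u(1) by (cases i) auto
  have d: "u GX * p GX + u GY * p GY + u GZ * p GZ = 0" using u(2) by (simp add: dot_def sum_gen3)
  show ?thesis
  proof (cases j)
  
    case GX
    obtain v1 v2 v3 where v: "\<forall>c1 c2 c3. c1 * p GY + c2 * p GZ + c3 * p GX = 0 \<longrightarrow>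
      (\<exists>g h. c1 = g * u GY + h * v1 \<and> c2 = g * u GZ + h * v2 \<and> c3 = g * u GX + h * v3)"
      using plane_coordinates[of "p GX" "u GY" "u GZ" "u GX" "p GY" "p GZ"] p nz d GX
      by (auto simp: add_ac)
    show ?thesis
    proof (intro exI[of _ "case_gen3 v3 v1 v2"] allI impI)
      fix c assume "dot c p = 0"
      then have "c GY * p GY + c GZ * p GZ + c GX * p GX = 0"
        by (simp add: dot_def sum_gen3 add_ac)
      from v[rule_format, OF this] show "\<exists>g h. \<forall>j. c j = g * u j + h * case_gen3 v3 v1 v2 j"
        by (auto simp: all_gen3)
    qed
  next
    case GY
    obtain v1 v2 v3 where v: "\<forall>c1 c2 c3. c1 * p GZ + c2 * p GX + c3 * p GY = 0 \<longrightarrow>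
      (\<exists>g h. c1 = g * u GZ + h * v1 \<and> c2 = g * u GX + h * v2 \<and> c3 = g * u GY + h * v3)"
      using plane_coordinates[of "p GY" "u GZ" "u GX" "u GY" "p GZ" "p GX"] p nz d GY
      by (auto simp: add_ac)
    show ?thesis
    proof (intro exI[of _ "case_gen3 v2 v3 v1"] allI impI)
      fix c assume "dot c p = 0"
      then have "c GZ * p GZ + c GX * p GX + c GY * p GY = 0"
        by (simp add: dot_def sum_gen3 add_ac)
      from v[rule_format, OF this] show "\<exists>g h. \<forall>j. c j = g * u j + h * case_gen3 v2 v3 v1 j"
        by (auto simp: all_gen3)
    qed
  next
    case GZ
    obtain v1 v2 v3 where v: "\<forall>c1 c2 c3. c1 * p GX + c2 * p GY + c3 * p GZ = 0 \<longrightarrow>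
      (\<exists>g h. c1 = g * u GX + h * v1 \<and> c2 = g * u GY + h * v2 \<and> c3 = g * u GZ + h * v3)"
      using plane_coordinates[of "p GZ" "u GX" "u GY" "u GZ" "p GX" "p GY"] p nz d GZ
      by (auto simp: add_ac)
    show ?thesis
    proof (intro exI[of _ "case_gen3 v1 v2 v3"] allI impI)
      fix c assume "dot c p = 0"
      then have "c GX * p GX + c GY * p GY + c GZ * p GZ = 0"
        by (simp add: dot_def sum_gen3 add_ac)
      from v[rule_format, OF this] show "\<exists>g h. \<forall>j. c j = g * u j + h * case_gen3 v1 v2 v3 j"
        by (auto simp: all_gen3)
    qed
  qed
qed

text \<open>Cramer's rule in the plane spanned by two vectors, which is the orthogonal complement of their
  cross product.\<close>

lemma cross_coordinates:
  fixes a1 :: "'k::field"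
  assumes "a1 * b2 - a2 * b1 \<noteq> 0"
    "c1 * (a2 * b3 - a3 * b2) + c2 * (a3 * b1 - a1 * b3) + c3 * (a1 * b2 - a2 * b1) = 0"
  shows "\<exists>g h. c1 = g * a1 + h * b1 \<and> c2 = g * a2 + h * b2 \<and> c3 = g * a3 + h * b3"
proof -
  define D where "D = a1 * b2 - a2 * b1"
  have D: "D \<noteq> 0" using assms(1) by (simp add: D_def)
  have "c3 * D = (c1 * b2 - c2 * b1) * a3 + (a1 * c2 - a2 * c1) * b3"
    using assms(2) unfolding D_def by (simp add: algebra_simps)
  moreover have "c1 * D = (c1 * b2 - c2 * b1) * a1 + (a1 * c2 - a2 * c1) * b1"
    "c2 * D = (c1 * b2 - c2 * b1) * a2 + (a1 * c2 - a2 * c1) * b2"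
    unfolding D_def by (simp_all add: algebra_simps)
  ultimately show ?thesis
    using D by (intro exI[of _ "(c1 * b2 - c2 * b1) / D"] exI[of _ "(a1 * c2 - a2 * c1) / D"])
      (simp add: divide_simps)
qed

lemma orthogonal_to_cross:
  assumes "cross a b k \<noteq> 0" "dot c (cross a b) = 0"
  obtains g h where "\<And>j. c j = g * a j + h * b j"
proof -
  have "\<exists>g h. \<forall>j. c j = g * a j + h * b j"
  proof (cases k)
  
    case GX
    then show ?thesis
      using cross_coordinates[of "a GY" "b GZ" "a GZ" "b GY" "c GY" "b GX" "a GX" "c GZ" "c GX"] assms
      by (auto simp: dot_def sum_gen3 cross_def add_ac all_gen3)
  next
    case GY
    then show ?thesis
      using cross_coordinates[of "a GZ" "b GX" "a GX" "b GZ" "c GZ" "b GY" "a GY" "c GX" "c GY"] assms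
      by (auto simp: dot_def sum_gen3 cross_def add_ac all_gen3)
  next
    case GZ
    then show ?thesis
      using cross_coordinates[of "a GX" "b GY" "a GY" "b GX" "c GX" "b GZ" "a GZ" "c GY" "c GZ"] assms
      by (auto simp: dot_def sum_gen3 cross_def add_ac all_gen3)
  qed
  then obtain g h where "\<forall>j. c j = g * a j + h * b j" by blast
  then show ?thesis by (intro that) simp
qed

lemma lin_linear: "lin (\<lambda>j. g * a j + h * b j) = smul g (lin a) + smul h (lin b)"
  by (simp add: lin_def sum_gen3 fv.scale_right_distrib fv.scale_left_distrib algebra_simps)

lemma lin_sum: "lin (\<lambda>k. \<Sum>j\<in>A. c j * M j k) = (\<Sum>j\<in>A. smul (c j) (lin (M j)))"
  unfolding lin_def
  by (simp add: fv.scale_sum_left fv.scale_sum_right sum.swap[of _ UNIV A] flip: fv.scale_scale)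

definition form2 :: "(gen3 \<Rightarrow> gen3 \<Rightarrow> 'k) \<Rightarrow> 'k::field free3"
  where "form2 M = (\<Sum>j\<in>UNIV. var j * lin (M j))"

lemma form2_hom_part: "form2 M \<in> hom_part 2"
  unfolding form2_def numeral_2_eq_2
  by (intro fv.subspace_sum[OF hom_part_subspace] var_mult_hom_part)
    (metis One_nat_def lin_in_hom_part)

lemma form2_sum: "form2 (\<lambda>j k. \<Sum>i\<in>A. t i * T i j k) = (\<Sum>i\<in>A. smul (t i) (form2 (T i)))"
  unfolding form2_def lin_sum
  by (simp add: sum_distrib_left fv.scale_sum_right sum.swap[of _ UNIV A])

lemma form2_tensors: "form2 (\<lambda>j k. g k * u j + h k * v j) = lin u * lin g + lin v * lin h"
proof -
  have *: "lin (\<lambda>k. g k * a + h k * b) = smul a (lin g) + smul b (lin h)" for a b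
    using lin_linear[of a g b h] by (simp add: mult.commute)
  show ?thesis
    unfolding form2_def *
    by (simp add: lin_def sum_distrib_right sum.distrib distrib_left)
qed

lemma hcomp_lin_mult: "hcomp (Suc n) (lin u * f) = lin u * hcomp n f"
  by (simp add: lin_def sum_gen3 distrib_right hcomp_add hcomp_smul hcomp_var_mult)

lemma hcomp_hom: "hcomp n f \<in> hom_part n"
  by (simp add: hom_part_iff lookup_hcomp)

lemma hcomp_diff: "hcomp n (f - g) = hcomp n f - hcomp n g"
  by (rule poly_mapping_eqI) (simp add: lookup_hcomp lookup_minus when_def)

lemma hom_part_0: "f \<in> hom_part 0 \<Longrightarrow> \<exists>c. f = smul c 1"
  by (auto simp: hom_part_span words_def word_Nil fv.span_singleton)

lemma one_hom_part: "1 \<in> hom_part 0"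
  by (simp add: hom_part_span words_def word_Nil fv.span_base)


section \<open>Point modules, line modules and the upper bound\<close>

locale bilinear_relations =
  fixes T :: "gen3 \<Rightarrow> gen3 \<Rightarrow> gen3 \<Rightarrow> 'k::field"
begin

definition r :: "gen3 \<Rightarrow> 'k free3"
  where "r i = form2 (T i)"

sublocale quadratic_relations r
  by standard (simp add: r_def form2_hom_part)

abbreviation J :: "'k free3 set"
  where "J \<equiv> rel_ideal (range r)"

text \<open>The coefficients of the linear form \<open>r\<^sub>i(p, _)\<close>, the relation \<open>r\<^sub>i\<close> evaluated at \<open>p\<close> in its first
  factor.\<close>

definition row :: "(gen3 \<Rightarrow> 'k) \<Rightarrow> gen3 \<Rightarrow> gen3 \<Rightarrow> 'k"
  where "row p i = (\<lambda>k. \<Sum>j\<in>UNIV. p j * T i j k)"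

text \<open>Modulo the relations, the right ideals generated by all linear forms vanishing at a point \<open>p\<close>,
  and by one linear form \<open>u\<close>. The quotients of the free algebra are the modules attached to the
  point and to the line \<open>u = 0\<close>.\<close>

definition point_ideal :: "(gen3 \<Rightarrow> 'k) \<Rightarrow> 'k free3 set"
  where "point_ideal p = fv.span ({lin u * g | u g. dot u p = 0} \<union> J)"

definition line_ideal :: "(gen3 \<Rightarrow> 'k) \<Rightarrow> 'k free3 set"
  where "line_ideal u = {lin u * g + f | g f. f \<in> J}"

lemma point_ideal_subspace: "fv.subspace (point_ideal p)"
  by (simp add: point_ideal_def)

lemma point_ideal_lin: "dot u p = 0 \<Longrightarrow> lin u * g \<in> point_ideal p"
  by (auto simp: point_ideal_def intro: fv.span_base)

lemma point_ideal_J: "f \<in> J \<Longrightarrow> f \<in> point_ideal p"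
  by (auto simp: point_ideal_def intro: fv.span_base)

lemma line_ideal_J: "f \<in> J \<Longrightarrow> f \<in> line_ideal u"
  unfolding line_ideal_def by (rule CollectI, rule exI[of _ 0]) auto

lemma line_ideal_lin: "lin u * g \<in> line_ideal u"
  unfolding line_ideal_def by (rule CollectI, rule exI[of _ g], rule exI[of _ 0]) (simp add: rel_ideal_zero)

lemma line_ideal_add: "f \<in> line_ideal u \<Longrightarrow> g \<in> line_ideal u \<Longrightarrow> f + g \<in> line_ideal u"
proof -
  assume "f \<in> line_ideal u" "g \<in> line_ideal u"
  then obtain f1 f2 g1 g2 where "f = lin u * f1 + f2" "g = lin u * g1 + g2" "f2 \<in> J" "g2 \<in> J"
    unfolding line_ideal_def by blast
  then have "f + g = lin u * (f1 + g1) + (f2 + g2)" "f2 + g2 \<in> J"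
    by (auto simp: algebra_simps rel_ideal_add)
  then show ?thesis unfolding line_ideal_def by blast
qed

lemma J_hcomp: "f \<in> J \<Longrightarrow> hcomp n f \<in> J"
  using hcomp_rel_ideal[of f n] by (simp add: I_def)

text \<open>Every variable \<open>x\<^sub>i\<close> differs from \<open>p\<^sub>i w\<close>, where \<open>w = x\<^sub>j / p\<^sub>j\<close>, by a form vanishing at \<open>p\<close>. So
  modulo the point ideal the first letter of an element can be evaluated at \<open>p\<close>.\<close>

lemma eval_mod_point_ideal:
  assumes "p j \<noteq> 0"
  shows "(\<Sum>i\<in>UNIV. var i * g i) - smul (1 / p j) (var j) * (\<Sum>i\<in>UNIV. smul (p i) (g i)) \<in> point_ideal p"
proof -
  let ?u = "\<lambda>i k. (if k = i then 1 else 0) - (if k = j then p i / p j else 0)"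
  have "lin (?u i) = var i - smul (p i / p j) (var j)" for i
    by (cases i; cases j; simp add: lin_def sum_gen3 fv.scale_left_diff_distrib)
  then have "lin (?u i) * g i = var i * g i - smul (p i / p j) (var j * g i)" for i
    by (simp add: left_diff_distrib)
  then have "(\<Sum>i\<in>UNIV. var i * g i) - smul (1 / p j) (var j) * (\<Sum>i\<in>UNIV. smul (p i) (g i))
      = (\<Sum>i\<in>UNIV. lin (?u i) * g i)"
    by (simp add: sum_subtractf sum_distrib_left fv.scale_sum_right)
  moreover have "dot (?u i) p = 0" for i
    using assms by (cases i; cases j; simp add: dot_def sum_gen3)
  ultimately show ?thesis
    by (simp add: fv.subspace_sum[OF point_ideal_subspace] point_ideal_lin)
qed

end

text \<open>Geometrically, the relations evaluated at a point of the plane have rank at least two, and every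
  line contains a point where the rank is less than three. Excluding products of two linear forms
  keeps the next linear form in the induction for line modules from being zero.\<close>

locale nondegenerate_relations = bilinear_relations +
  assumes rank: "p j \<noteq> 0 \<Longrightarrow> \<exists>i i' k. cross (row p i) (row p i') k \<noteq> 0"
    and no_pure_tensor: "t i \<noteq> 0 \<Longrightarrow> (\<lambda>j k. \<Sum>i\<in>UNIV. t i * T i j k) \<noteq> (\<lambda>j k. g k * u j)"
    and incident: "u i \<noteq> 0 \<Longrightarrow> \<exists>p t. (\<exists>j. p j \<noteq> 0) \<and> dot u p = 0 \<and>
      (\<exists>j. t j \<noteq> 0) \<and> (\<forall>k. (\<Sum>i\<in>UNIV. t i * row p i k) = 0)"
begin

text \<open>The components of a point module have dimension at most one. The part of positive
  degree is generated by the class of a linear form \<open>w\<close> with value \<open>1\<close> at \<open>p\<close>, and this class is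
  annihilated by the forms \<open>r\<^sub>i(p, _)\<close>. Two of these are independent, so they span the forms vanishing
  at some point, their cross product, and the part of positive degree is a quotient of the module of
  that point.\<close>

lemma point_quotient:
  assumes "p j \<noteq> 0"
  shows "\<exists>s \<in> hom_part n. \<forall>f \<in> hom_part n. \<exists>c. f - smul c s \<in> point_ideal p"
  using assms
proof (induction n arbitrary: p j)
  case 0
  show ?case
  proof (intro bexI[of _ 1] ballI)
    fix f :: "'a free3" assume "f \<in> hom_part 0"
    then obtain c where "f = smul c 1" using hom_part_0 by blast
    then show "\<exists>c. f - smul c 1 \<in> point_ideal p"
      by (intro exI[of _ c]) (simp add: fv.subspace_0[OF point_ideal_subspace])
  qed (rule one_hom_part)
next
  case (Suc n)
  obtain i i' k where k: "cross (row p i) (row p i') k \<noteq> 0" using rank[of p j, OF Suc.prems] by blast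
  let ?p' = "cross (row p i) (row p i')" and ?w = "smul (1 / p j) (var j)"
  obtain s where s: "s \<in> hom_part n" "\<And>f. f \<in> hom_part n \<Longrightarrow> \<exists>c. f - smul c s \<in> point_ideal ?p'"
    using Suc.IH[of ?p', OF k] by blast
  have row_step: "?w * (lin (row p l) * g) \<in> point_ideal p" for l g
  proof -
    have 1: "r l * g - ?w * (\<Sum>j\<in>UNIV. smul (p j) (lin (T l j) * g)) \<in> point_ideal p"
      using eval_mod_point_ideal[of p j "\<lambda>i. lin (T l i) * g", OF Suc.prems]
      by (simp add: r_def form2_def sum_distrib_right mult.assoc)
    have 2: "r l * g \<in> point_ideal p"
      by (intro point_ideal_J rel_ideal_mult_right rel_in_ideal)
    have "(\<Sum>j\<in>UNIV. smul (p j) (lin (T l j) * g)) = lin (row p l) * g"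
      unfolding row_def lin_sum by (simp add: sum_distrib_right)
    then show ?thesis
      using fv.subspace_diff[OF point_ideal_subspace 2 1] by simp
  qed
  have step: "?w * x \<in> point_ideal p" if "x \<in> point_ideal ?p'" for x
    using that unfolding point_ideal_def[of ?p']
  proof (induction rule: fv.span_induct_alt)
    case base
    show ?case by (simp add: fv.subspace_0[OF point_ideal_subspace])
  next
    case (step c x y)
    have "?w * x \<in> point_ideal p"
      using step(1)
    proof
      assume "x \<in> J"
      then show ?thesis by (intro point_ideal_J rel_ideal_mult_left)
    next
      assume "x \<in> {lin u * g | u g. dot u ?p' = 0}"
      then obtain u g where ug: "x = lin u * g" "dot u ?p' = 0" by blast
      obtain \<mu> \<nu> where "\<And>j. u j = \<mu> * row p i j + \<nu> * row p i' j"
        using orthogonal_to_cross[OF k ug(2)] by blast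
      then have "u = (\<lambda>j. \<mu> * row p i j + \<nu> * row p i' j)" by (intro ext)
      then have "?w * x = smul \<mu> (?w * (lin (row p i) * g)) + smul \<nu> (?w * (lin (row p i') * g))"
        by (simp add: ug(1) lin_linear distrib_left distrib_right fv.scale_right_distrib)
      then show ?thesis
        using fv.subspace_add[OF point_ideal_subspace
            fv.subspace_scale[OF point_ideal_subspace row_step[of i g], of \<mu>]
            fv.subspace_scale[OF point_ideal_subspace row_step[of i' g], of \<nu>]] by simp
    qed
    then have "smul c (?w * x) + ?w * y \<in> point_ideal p"
      by (intro fv.subspace_add[OF point_ideal_subspace] fv.subspace_scale[OF point_ideal_subspace] step(2))
    then show ?case by (simp add: distrib_left fv.scale_right_distrib mult.commute)
  qed
  have wh: "?w \<in> hom_part 1"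
    by (intro fv.subspace_scale[OF hom_part_subspace] var_in_hom_part)
  show ?case
  proof (intro bexI[of _ "?w * s"] ballI)
    show "?w * s \<in> hom_part (Suc n)" using hom_part_mult[OF wh s(1)] by simp
    fix f :: "'a free3" assume "f \<in> hom_part (Suc n)"
    then obtain g where g: "\<And>i. g i \<in> hom_part n" "f = (\<Sum>i\<in>UNIV. var i * g i)"
      by (rule hom_part_SucE) blast
    let ?G = "\<Sum>i\<in>UNIV. smul (p i) (g i)"
    have "?G \<in> hom_part n"
      by (intro fv.subspace_sum[OF hom_part_subspace] fv.subspace_scale[OF hom_part_subspace] g(1))
    then obtain c where "?G - smul c s \<in> point_ideal ?p'" using s(2) by blast
    then have "?w * (?G - smul c s) \<in> point_ideal p" by (rule step)
    moreover have "f - ?w * ?G \<in> point_ideal p"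
      unfolding g(2) using Suc.prems by (rule eval_mod_point_ideal)
    ultimately have "f - ?w * ?G + ?w * (?G - smul c s) \<in> point_ideal p"
      by (intro fv.subspace_add[OF point_ideal_subspace])
    then have "f - smul c (?w * s) \<in> point_ideal p"
      by (simp add: right_diff_distrib fv.scale_left_commute fv.scale_right_diff_distrib)
    then show "\<exists>c. f - smul c (?w * s) \<in> point_ideal p" by blast
  qed
qed

text \<open>The point \<open>p\<close> on the line \<open>u = 0\<close> at which the rank drops gives a combination of the relations that
  vanishes at \<open>p\<close> in its first factor, that is \<open>u g + v h\<close> where \<open>u\<close>, \<open>v\<close> span the forms
  vanishing at \<open>p\<close>. In the line module this says \<open>v h = 0\<close>, so \<open>v\<close> generates a quotient of the line
  module of \<open>h\<close>, with at most \<open>n + 1\<close> dimensions in the relevant degree. Dividing by it as well leaves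
  the point module of \<open>p\<close>, which adds at most one.\<close>

lemma line_quotient:
  assumes "\<exists>i. u i \<noteq> 0"
  shows "\<exists>S. finite S \<and> card S \<le> Suc n \<and> S \<subseteq> hom_part n \<and>
    (\<forall>f \<in> hom_part n. \<exists>s \<in> fv.span S. f - s \<in> line_ideal u)"
  using assms
proof (induction n arbitrary: u)
  case 0
  show ?case
  proof (intro exI[of _ "{1}"] conjI ballI)
    fix f :: "'a free3" assume "f \<in> hom_part 0"
    then obtain c where "f = smul c 1" using hom_part_0 by blast
    then show "\<exists>s \<in> fv.span {1}. f - s \<in> line_ideal u"
      by (intro bexI[of _ f]) (auto simp: line_ideal_J rel_ideal_zero fv.span_singleton)
  qed (simp_all add: one_hom_part)
next
  case (Suc n)
  obtain i where ui: "u i \<noteq> 0" using Suc.prems by (rule exE)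
  obtain p t j l where pt: "p j \<noteq> 0" "dot u p = 0" "t l \<noteq> 0"
    "\<And>k. (\<Sum>i\<in>UNIV. t i * row p i k) = 0"
    using incident[of u, OF ui] by blast
  obtain v where "\<forall>c. dot c p = 0 \<longrightarrow> (\<exists>g h. \<forall>j. c j = g * u j + h * v j)"
    using vanishing_forms_spanned[of p j u, OF pt(1) ui pt(2)] by (rule exE)
  then have v: "\<exists>g h. \<forall>j. c j = g * u j + h * v j" if "dot c p = 0" for c
    using that by simp
  define M where "M = (\<lambda>j k. \<Sum>i\<in>UNIV. t i * T i j k)"
  have "dot (\<lambda>j. M j k) p = 0" for k
    using pt(4)[of k] by (simp add: M_def dot_def row_def sum_gen3 algebra_simps)
  then have "\<exists>g h. \<forall>j. M j k = g * u j + h * v j" for k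
    by (rule v)
  then obtain g h where "\<And>k j. M j k = g k * u j + h k * v j"
    by metis
  then have gh: "M = (\<lambda>j k. g k * u j + h k * v j)" by (intro ext)
  have M: "form2 M = lin u * lin g + lin v * lin h"
    unfolding gh by (rule form2_tensors)
  have MJ: "form2 M \<in> J"
    unfolding M_def form2_sum r_def[symmetric]
    by (intro fv.subspace_sum[OF rel_ideal_subspace] fv.subspace_scale[OF rel_ideal_subspace]
        rel_in_ideal)
  \<comment> \<open>Otherwise the combination would be the pure tensor \<open>u g\<close>.\<close>
  have h: "\<exists>m. h m \<noteq> 0"
  proof (rule ccontr)
    assume "\<nexists>m. h m \<noteq> 0"
    then have "M = (\<lambda>j k. g k * u j)" unfolding gh by simp
    then show False using no_pure_tensor[of t, OF pt(3)] by (simp add: M_def)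
  qed
  obtain S where S: "finite S" "card S \<le> Suc n" "S \<subseteq> hom_part n"
    "\<And>f. f \<in> hom_part n \<Longrightarrow> \<exists>s \<in> fv.span S. f - s \<in> line_ideal h"
    using Suc.IH[OF h] by blast
  obtain s where s: "s \<in> hom_part (Suc n)"
    "\<And>f. f \<in> hom_part (Suc n) \<Longrightarrow> \<exists>c. f - smul c s \<in> point_ideal p"
    using point_quotient[of p, OF pt(1)] by blast
  have vh: "lin v * x \<in> line_ideal u" if x: "x \<in> line_ideal h" for x
  proof -
    obtain y f where yf: "x = lin h * y + f" "f \<in> J" using x by (auto simp: line_ideal_def)
    have "lin v * x = lin u * (- (lin g * y)) + (form2 M * y + lin v * f)"
      unfolding M yf(1) by (simp add: algebra_simps)
    moreover have "form2 M * y + lin v * f \<in> J"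
      by (rule rel_ideal_add[OF rel_ideal_mult_right[OF MJ] rel_ideal_mult_left[OF yf(2)]])
    ultimately show ?thesis unfolding line_ideal_def by blast
  qed
  have uv: "\<exists>x1 x2 f. x = lin u * x1 + lin v * x2 + f \<and> f \<in> J" if "x \<in> point_ideal p" for x
    using that unfolding point_ideal_def
  proof (induction rule: fv.span_induct_alt)
    case base
    show ?case by (rule exI[of _ 0], rule exI[of _ 0], rule exI[of _ 0]) (simp add: rel_ideal_zero)
  next
    case (step c x y)
    obtain y1 y2 f where y: "y = lin u * y1 + lin v * y2 + f" "f \<in> J" using step(2) by blast
    have "\<exists>x1 x2 f. x = lin u * x1 + lin v * x2 + f \<and> f \<in> J"
      using step(1)
    proof
      assume "x \<in> J"
      then show ?thesis by (intro exI[of _ 0] exI[of _ x]) simp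
    next
      assume "x \<in> {lin u * g | u g. dot u p = 0}"
      then obtain w z where wz: "x = lin w * z" "dot w p = 0" by blast
      obtain \<mu> \<nu> where "\<forall>j. w j = \<mu> * u j + \<nu> * v j" using v[OF wz(2)] by blast
      then have "w = (\<lambda>j. \<mu> * u j + \<nu> * v j)" by (intro ext) simp
      then show ?thesis
        by (intro exI[of _ "smul \<mu> z"] exI[of _ "smul \<nu> z"] exI[of _ 0])
          (simp add: wz(1) lin_linear distrib_right rel_ideal_zero)
    qed
    then obtain x1 x2 f' where x: "x = lin u * x1 + lin v * x2 + f'" "f' \<in> J" by blast
    show ?case
      by (rule exI[of _ "smul c x1 + y1"], rule exI[of _ "smul c x2 + y2"], rule exI[of _ "smul c f' + f"])
        (use x(1) y(1) rel_ideal_add[OF fv.subspace_scale[OF rel_ideal_subspace x(2)] y(2), of c] in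
          \<open>simp add: distrib_left fv.scale_right_distrib add_ac\<close>)
  qed
  let ?S = "insert s ((*) (lin v) ` S)"
  show ?case
  proof (intro exI[of _ ?S] conjI ballI)
    show "finite ?S" using S(1) by simp
    show "card ?S \<le> Suc (Suc n)"
      using card_insert_le_m1[of "Suc (Suc n)" "(*) (lin v) ` S" s] card_image_le[OF S(1), of "(*) (lin v)"] S(2) by simp
    show "?S \<subseteq> hom_part (Suc n)" using s(1) S(3) lin_mult_hom_part by auto
    fix f :: "'a free3" assume f: "f \<in> hom_part (Suc n)"
    then obtain c where "f - smul c s \<in> point_ideal p" using s(2) by blast
    then obtain x1 x2 z where x: "f - smul c s = lin u * x1 + lin v * x2 + z" "z \<in> J" using uv by blast
    have "hcomp (Suc n) (f - smul c s) = f - smul c s"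
      using f s(1) by (simp add: hcomp_diff hcomp_smul hcomp_hom_part)
    then have eq: "f - smul c s = lin u * hcomp n x1 + lin v * hcomp n x2 + hcomp (Suc n) z"
      unfolding x(1) by (simp add: hcomp_add hcomp_lin_mult)
    obtain y where y: "y \<in> fv.span S" "hcomp n x2 - y \<in> line_ideal h"
      using S(4)[OF hcomp_hom] by blast
    have "lin u * hcomp n x1 + (lin v * (hcomp n x2 - y) + hcomp (Suc n) z) \<in> line_ideal u"
      by (rule line_ideal_add[OF line_ideal_lin line_ideal_add[OF vh[OF y(2)] line_ideal_J[OF J_hcomp[OF x(2)]]]])
    moreover have "f - (smul c s + lin v * y) = lin u * hcomp n x1 + (lin v * (hcomp n x2 - y) + hcomp (Suc n) z)"
      using eq by (simp add: algebra_simps)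
    moreover have "smul c s + lin v * y \<in> fv.span ?S"
    proof (intro fv.span_add)
      show "smul c s \<in> fv.span ?S" by (intro fv.span_scale fv.span_base) simp
      show "lin v * y \<in> fv.span ?S"
        using span_mult_left[OF y(1), of "lin v"] fv.span_mono[of "(*) (lin v) ` S" ?S] by auto
    qed
    ultimately show "\<exists>s \<in> fv.span ?S. f - s \<in> line_ideal u"
      by (intro bexI[of _ "smul c s + lin v * y"]) simp_all
  qed
qed

text \<open>The component of degree \<open>n + 1\<close> consists of multiples of \<open>u\<close> and of the line module of \<open>u\<close>. The
  set \<open>S\<close> spans degree \<open>n\<close> only up to the kernel of the multiplication by \<open>u\<close>, which makes it possible
  to detect this kernel.\<close>

lemma qdim_Suc_le:
  assumes u: "u i \<noteq> 0" and S: "finite S" "S \<subseteq> hom_part n"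
    "\<And>g. g \<in> hom_part n \<Longrightarrow> \<exists>s \<in> fv.span S. lin u * (g - s) \<in> J"
  shows "qdim (Suc n) \<le> card S + Suc (Suc n)"
proof -
  have nz: "\<exists>i. u i \<noteq> 0" using u by (rule exI)
  obtain L where L: "finite L" "card L \<le> Suc (Suc n)" "L \<subseteq> hom_part (Suc n)"
    "\<And>f. f \<in> hom_part (Suc n) \<Longrightarrow> \<exists>s \<in> fv.span L. f - s \<in> line_ideal u"
    using line_quotient[OF nz, of "Suc n"] by blast
  let ?X = "(*) (lin u) ` S \<union> L"
  have "qdim (Suc n) \<le> card ?X"
  proof (rule qdim_le_card)
    show "finite ?X" using S L by simp
    show "?X \<subseteq> hom_part (Suc n)" using S(2) L(3) by (auto intro!: lin_mult_hom_part)
    fix f :: "'a free3" assume f: "f \<in> hom_part (Suc n)"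
    then obtain s where s: "s \<in> fv.span L" "f - s \<in> line_ideal u" using L(4) by blast
    have sh: "s \<in> hom_part (Suc n)"
      using s(1) fv.span_minimal[OF L(3) hom_part_subspace] by blast
    obtain g z where gz: "f - s = lin u * g + z" "z \<in> J" using s(2) by (auto simp: line_ideal_def)
    have "f - s = hcomp (Suc n) (f - s)"
      using f sh by (simp add: hcomp_diff hcomp_hom_part)
    also have "\<dots> = lin u * hcomp n g + hcomp (Suc n) z"
      unfolding gz(1) by (simp add: hcomp_add hcomp_lin_mult)
    finally have fs: "f - s = lin u * hcomp n g + hcomp (Suc n) z" .
    obtain y where y: "y \<in> fv.span S" "lin u * (hcomp n g - y) \<in> J" using S(3)[OF hcomp_hom] by blast
    have "f - (lin u * y + s) = lin u * (hcomp n g - y) + hcomp (Suc n) z"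
      using fs by (simp add: algebra_simps)
    also have "\<dots> \<in> J" using y(2) J_hcomp[OF gz(2)] by (rule rel_ideal_add)
    finally have "f - (lin u * y + s) \<in> J" .
    moreover have "lin u * y + s \<in> fv.span ?X"
      unfolding fv.span_Un using span_mult_left[OF y(1)] s(1) by blast
    ultimately show "\<exists>s \<in> fv.span ?X. f - s \<in> J" by blast
  qed
  also have "\<dots> \<le> card S + Suc (Suc n)"
    using card_Un_le[of "(*) (lin u) ` S" L] card_image_le[OF S(1), of "(*) (lin u)"] L(2) by linarith
  finally show ?thesis .
qed

lemma qdim_Suc_upper: "qdim (Suc n) \<le> qdim n + Suc (Suc n)"
proof -
  obtain S where S: "S \<subseteq> hom_part n" "finite S"
    "\<And>f. f \<in> hom_part n \<Longrightarrow> \<exists>s \<in> fv.span S. f - s \<in> I n" "card S = qdim n"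
    by (rule basis_mod_I[of "{}" n]) (auto simp: fv.independent_empty)
  have "qdim (Suc n) \<le> card S + Suc (Suc n)"
  proof (rule qdim_Suc_le[of "\<lambda>_. 1" GX])
    fix g :: "'a free3" assume "g \<in> hom_part n"
    then obtain s where "s \<in> fv.span S" "g - s \<in> I n" using S(3) by blast
    then show "\<exists>s \<in> fv.span S. lin (\<lambda>_. 1) * (g - s) \<in> J"
      by (intro bexI[of _ s]) (auto simp: I_def rel_ideal_mult_left)
  qed (use S(1,2) in simp_all)
  then show ?thesis by (simp add: S(4))
qed

text \<open>Equality in the upper bound forces left multiplication by linear forms to be injective:
  an element of the kernel could be left out of a basis of degree \<open>n\<close>.\<close>

lemma lin_regular:
  assumes max: "qdim (Suc n) = qdim n + Suc (Suc n)" and u: "u i \<noteq> 0"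
    and f: "f \<in> hom_part n" "lin u * f \<in> J"
  shows "f \<in> J"
proof (rule ccontr)
  assume nf: "f \<notin> J"
  then have "f \<noteq> 0" using rel_ideal_zero by blast
  have "fv.span {f} \<inter> I n \<subseteq> {0}"
  proof
    fix x assume "x \<in> fv.span {f} \<inter> I n"
    then obtain c where c: "x = smul c f" "x \<in> J" by (auto simp: fv.span_singleton I_def)
    have "c = 0"
    proof (rule ccontr)
      assume "c \<noteq> 0"
      then have "f = smul (inverse c) x" by (simp add: c(1))
      then show False using nf fv.subspace_scale[OF rel_ideal_subspace c(2), of "inverse c"] by simp
    qed
    then show "x \<in> {0}" using c(1) by simp
  qed
  note triv = this
  obtain S where S: "{f} \<subseteq> S" "S \<subseteq> hom_part n" "finite S"
    "\<And>f. f \<in> hom_part n \<Longrightarrow> \<exists>s \<in> fv.span S. f - s \<in> I n" "card S = qdim n"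
    by (rule basis_mod_I[of "{f}" n]) (use triv f(1) \<open>f \<noteq> 0\<close> in \<open>auto simp: fv.dependent_single\<close>)
  have "qdim (Suc n) \<le> card (S - {f}) + Suc (Suc n)"
  proof (rule qdim_Suc_le[of u, OF u])
    fix g :: "'a free3" assume "g \<in> hom_part n"
    then obtain s where s: "s \<in> fv.span S" "g - s \<in> J" using S(4) by (auto simp: I_def)
    have "S = insert f (S - {f})" using S(1) by blast
    then obtain c where c: "s - smul c f \<in> fv.span (S - {f})"
      using s(1) by (metis fv.span_breakdown_eq)
    have "lin u * (g - (s - smul c f)) = lin u * (g - s) + smul c (lin u * f)"
      by (simp add: algebra_simps)
    also have "\<dots> \<in> J"
      by (rule rel_ideal_add[OF rel_ideal_mult_left[OF s(2)] fv.subspace_scale[OF rel_ideal_subspace f(2)]])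
    finally show "\<exists>s \<in> fv.span (S - {f}). lin u * (g - s) \<in> J" using c by blast
  qed (use S in auto)
  moreover have "card (S - {f}) < card S" using S(1,3) by (intro psubset_card_mono) auto
  ultimately show False using max S(5) by simp
qed

end


section \<open>Superpotentials and the lower bound\<close>

text \<open>A twisted superpotential is an element of \<open>R V \<inter> V R\<close>.\<close>

locale superpotential_relations = nondegenerate_relations +
  fixes l m :: "gen3 \<Rightarrow> gen3 \<Rightarrow> 'a" and i\<^sub>0 j\<^sub>0 :: gen3
  assumes overlap: "(\<Sum>i\<in>UNIV. r i * lin (l i)) = (\<Sum>i\<in>UNIV. lin (m i) * r i)"
    and nonzero: "l i\<^sub>0 j\<^sub>0 \<noteq> 0"
begin

text \<open>In \<open>I\<^sub>n\<^sub>+\<^sub>3 = V I\<^sub>n\<^sub>+\<^sub>2 + R F\<^sub>n\<^sub>+\<^sub>1\<close> the factor \<open>F\<^sub>n\<^sub>+\<^sub>1\<close> only matters modulo \<open>I\<^sub>n\<^sub>+\<^sub>1\<close>, which leaves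
  \<open>3 dim A\<^sub>n\<^sub>+\<^sub>1\<close> generators beside \<open>V I\<^sub>n\<^sub>+\<^sub>2\<close>. Multiplying the superpotential by \<open>f\<close> in \<open>F\<^sub>n\<close> expresses
  \<open>r l f\<close>, for one relation \<open>r\<close> and one linear form \<open>l \<noteq> 0\<close>, by the other generators. Left multiplication
  by \<open>l\<close> is injective on \<open>A\<^sub>n\<close>, so that \<open>dim A\<^sub>n\<close> generators can be omitted.\<close>

lemma qdim_lower_step:
  assumes max: "qdim (Suc n) = qdim n + Suc (Suc n)"
  shows "3 * qdim (Suc (Suc n)) + qdim n \<le> qdim (Suc (Suc (Suc n))) + 3 * qdim (Suc n)"
proof -
  let ?h = "(*) (lin (l i\<^sub>0)) :: 'a free3 \<Rightarrow> 'a free3"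
  interpret h: module_hom smul smul ?h
    by unfold_locales (simp_all add: distrib_left)
  obtain T' where T: "T' \<subseteq> hom_part n" "finite T'" "fv.independent T'" "fv.span T' \<inter> I n \<subseteq> {0}"
    "card T' = qdim n"
    by (rule basis_mod_I[of "{}" n]) (auto simp: fv.independent_empty)
  have regular: "f = 0" if "f \<in> fv.span T'" "?h f \<in> J" for f
  proof -
    have "f \<in> hom_part n" using that(1) fv.span_minimal[OF T(1) hom_part_subspace] by blast
    moreover from this have "f \<in> J" by (rule lin_regular[OF max nonzero _ that(2)])
    ultimately show ?thesis using T(4) that(1) by (auto simp: I_def)
  qed
  have inj: "inj_on ?h (fv.span T')"
    using regular by (subst h.inj_on_iff_eq_0[OF fv.subspace_span]) (simp add: rel_ideal_zero)
  have indep: "fv.independent (?h ` T')"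
    by (rule h.independent_injective_image[OF T(3) inj])
  have triv: "fv.span (?h ` T') \<inter> I (Suc n) \<subseteq> {0}"
  proof
    fix x assume "x \<in> fv.span (?h ` T') \<inter> I (Suc n)"
    then obtain f where "f \<in> fv.span T'" "x = ?h f" "?h f \<in> J"
      by (auto simp: h.span_image I_def)
    moreover from this have "f = 0" by (intro regular)
    ultimately show "x \<in> {0}" by simp
  qed
  have sub: "?h ` T' \<subseteq> hom_part (Suc n)" using T(1) lin_mult_hom_part by auto
  \<comment> \<open>The basis of degree \<open>n + 1\<close> contains the multiples of \<open>l\<close>, whose products with \<open>r\<close> are to be omitted.\<close>
  obtain S where S: "?h ` T' \<subseteq> S" "S \<subseteq> hom_part (Suc n)" "finite S"
    "\<And>f. f \<in> hom_part (Suc n) \<Longrightarrow> \<exists>s \<in> fv.span S. f - s \<in> I (Suc n)" "card S = qdim (Suc n)"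
    by (rule basis_mod_I[OF sub finite_imageI[OF T(2)] indep triv]) blast
  have cardT: "card (?h ` T') = qdim n"
    using T(5) card_image[OF inj_on_subset[OF inj fv.span_superset]] by simp
  obtain B where B: "fv.span B = I (Suc (Suc n))" "finite B" "card B = fv.dim (I (Suc (Suc n)))"
    using fv.finite_basis_of_bounded_subspace[OF I_subspace _ finite_words, of "Suc (Suc n)" "Suc (Suc n)"] I_subset
    by (metis hom_part_span)
  define E where "E = (\<Union>j. (*) (var j) ` B) \<union> (\<Union>i\<in>UNIV - {i\<^sub>0}. (*) (r i) ` S) \<union> (*) (r i\<^sub>0) ` (S - ?h ` T')"
  have spanE: "fv.subspace (fv.span E)" by simp
  have var_E: "var j * g \<in> fv.span E" if "g \<in> I (Suc (Suc n))" for j g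
  proof -
    have "var j * g \<in> fv.span ((*) (var j) ` B)" using that B(1) span_mult_left by metis
    also have "\<dots> \<subseteq> fv.span E" by (rule fv.span_mono) (auto simp: E_def)
    finally show ?thesis .
  qed
  have lin_E: "lin c * g \<in> fv.span E" if "g \<in> I (Suc (Suc n))" for c g
    unfolding lin_def sum_distrib_right smul_mult_left
    by (intro fv.span_sum fv.span_scale var_E that)
  have rel_I: "r i * w \<in> fv.span E" if "w \<in> I (Suc n)" for i w
    unfolding r_def form2_def sum_distrib_right mult.assoc
    by (intro fv.span_sum var_E I_lin_mult that)
  have rel_ne: "r i * f \<in> fv.span E" if "i \<noteq> i\<^sub>0" "f \<in> hom_part (Suc n)" for i f
  proof -
    obtain s where s: "s \<in> fv.span S" "f - s \<in> I (Suc n)" using S(4) \<open>f \<in> hom_part (Suc n)\<close> by blast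
    have "r i * s \<in> fv.span ((*) (r i) ` S)" using s(1) by (rule span_mult_left)
    also have "\<dots> \<subseteq> fv.span E" using that(1) by (intro fv.span_mono) (auto simp: E_def)
    finally have "r i * s + r i * (f - s) \<in> fv.span E"
      using rel_I[OF s(2), of i] by (rule fv.span_add)
    then show ?thesis by (simp add: right_diff_distrib)
  qed
  have rel_T: "r i\<^sub>0 * ?h t \<in> fv.span E" if "t \<in> T'" for t
  proof -
    have t: "t \<in> hom_part n" using that T(1) by blast
    have "(\<Sum>i\<in>UNIV. r i * (lin (l i) * t)) = (\<Sum>i\<in>UNIV. lin (m i) * (r i * t))"
      using arg_cong[OF overlap, of "\<lambda>x. x * t"] by (simp add: sum_distrib_right mult.assoc)
    moreover have "(\<Sum>i\<in>UNIV. r i * (lin (l i) * t))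
        = r i\<^sub>0 * ?h t + (\<Sum>i\<in>UNIV - {i\<^sub>0}. r i * (lin (l i) * t))"
      by (rule sum.remove) auto
    ultimately have eq: "r i\<^sub>0 * ?h t = (\<Sum>i\<in>UNIV. lin (m i) * (r i * t))
        - (\<Sum>i\<in>UNIV - {i\<^sub>0}. r i * (lin (l i) * t))"
      by (simp add: algebra_simps)
    show ?thesis
      unfolding eq
      by (intro fv.span_diff fv.span_sum lin_E I_rel_mult t rel_ne lin_mult_hom_part) auto
  qed
  have rel_S: "r i\<^sub>0 * s \<in> fv.span E" if "s \<in> S" for s
  proof (cases "s \<in> ?h ` T'")
    case True
    then show ?thesis using rel_T by auto
  next
    case False
    then show ?thesis using that by (auto simp: E_def intro: fv.span_base)
  qed
  have rel_0: "r i\<^sub>0 * f \<in> fv.span E" if f: "f \<in> hom_part (Suc n)" for f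
  proof -
    obtain s where s: "s \<in> fv.span S" "f - s \<in> I (Suc n)" using S(4) f by blast
    have "r i\<^sub>0 * s \<in> fv.span ((*) (r i\<^sub>0) ` S)" using s(1) by (rule span_mult_left)
    also have "\<dots> \<subseteq> fv.span E" using rel_S by (intro fv.span_minimal[OF _ spanE]) auto
    finally have "r i\<^sub>0 * s + r i\<^sub>0 * (f - s) \<in> fv.span E"
      using rel_I[OF s(2), of "i\<^sub>0"] by (rule fv.span_add)
    then show ?thesis by (simp add: right_diff_distrib)
  qed
  have rel_E: "r i * f \<in> fv.span E" if "f \<in> hom_part (Suc n)" for i f
    using that rel_ne rel_0 by (cases "i = i\<^sub>0") auto
  have "relation_multiples r (Suc (Suc (Suc n))) \<subseteq> fv.span E"
  proof
    fix x assume "x \<in> relation_multiples r (Suc (Suc (Suc n)))"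
    then consider j g where "x = var j * g" "g \<in> relation_multiples r (Suc (Suc n))"
      | i w where "x = r i * w" "w \<in> words (Suc n)"
      unfolding relation_multiples.simps(3)[of r "Suc n"] by blast
    then show "x \<in> fv.span E"
    proof cases
      case 1
      then show ?thesis using var_E relation_multiples_subset by blast
    next
      case 2
      then show ?thesis using rel_E fv.span_base[of w "words (Suc n)"] by (simp add: hom_part_span)
    qed
  qed
  then have "I (Suc (Suc (Suc n))) \<subseteq> fv.span E"
    unfolding I_span by (rule fv.span_minimal[OF _ spanE])
  moreover have "finite E" unfolding E_def using B(2) S(3) by auto
  ultimately have d: "fv.dim (I (Suc (Suc (Suc n)))) \<le> card E" by (rule fv.dim_le_card)
  have "card (\<Union>j. (*) (var j) ` B) \<le> (\<Sum>j\<in>(UNIV :: gen3 set). card ((*) (var j) ` B))"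
    by (rule card_UN_le) simp
  also have "\<dots> \<le> (\<Sum>j\<in>(UNIV :: gen3 set). card B)"
    by (intro sum_mono card_image_le B(2))
  finally have c1: "card (\<Union>j. (*) (var j) ` B) \<le> 3 * card B" by (simp add: card_UNIV_gen3)
  have "card (\<Union>i\<in>UNIV - {i\<^sub>0}. (*) (r i) ` S) \<le> (\<Sum>i\<in>UNIV - {i\<^sub>0}. card ((*) (r i) ` S))"
    by (rule card_UN_le) simp
  also have "\<dots> \<le> (\<Sum>i\<in>UNIV - {i\<^sub>0}. card S)"
    by (intro sum_mono card_image_le S(3))
  finally have c2: "card (\<Union>i\<in>UNIV - {i\<^sub>0}. (*) (r i) ` S) \<le> 2 * card S"
    by (simp add: card_UNIV_gen3 card_Diff_singleton)
  have c3: "card ((*) (r i\<^sub>0) ` (S - ?h ` T')) + qdim n \<le> card S"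
    using card_image_le[of "S - ?h ` T'" "(*) (r i\<^sub>0)"] S(3) card_Diff_subset[OF finite_imageI[OF T(2)] S(1)]
      card_mono[OF S(3,1)] cardT by simp
  have "card E \<le> card (\<Union>j. (*) (var j) ` B) + card (\<Union>i\<in>UNIV - {i\<^sub>0}. (*) (r i) ` S)
      + card ((*) (r i\<^sub>0) ` (S - ?h ` T'))"
    unfolding E_def by (meson card_Un_le add_le_mono order_refl order_trans)
  then have "fv.dim (I (Suc (Suc (Suc n)))) + qdim n \<le> 3 * fv.dim (I (Suc (Suc n))) + 3 * qdim (Suc n)"
    using d c1 c2 c3 B(3) S(5) by linarith
  then show ?thesis
    using qdim_eq[of "Suc (Suc (Suc n))"] qdim_eq[of "Suc (Suc n)"] by simp
qed

lemma choose_step: "(Suc n + 2) choose 2 = ((n + 2) choose 2) + Suc (Suc n)"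
  using binomial_Suc_Suc[of "n + 2" 1] by (simp add: numeral_2_eq_2)

lemma qdim_0: "qdim 0 = 1" and qdim_1: "qdim 1 = 3" and qdim_2: "6 \<le> qdim 2"
proof -
  have "fv.dim (fv.span {} :: 'a free3 set) = 0"
    unfolding fv.dim_span_eq_card_independent[OF fv.independent_empty] by simp
  then show "qdim 0 = 1" "qdim 1 = 3"
    using qdim_eq[of 0] qdim_eq[of 1] by (simp_all add: I_span)
  have "fv.dim (I 2) \<le> card (range r)"
    unfolding I_span by (intro fv.dim_le_card fv.span_mono) (auto simp: numeral_2_eq_2 words_def word_Nil)
  also have "\<dots> \<le> card (UNIV :: gen3 set)" by (rule card_image_le) simp
  finally show "6 \<le> qdim 2" using qdim_eq[of 2] by (simp add: card_UNIV_gen3)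
qed

lemma qdim_upper: "qdim n \<le> (n + 2) choose 2"
proof (induction n)
  case 0
  then show ?case by (simp add: qdim_0 numeral_2_eq_2)
next
  case (Suc n)
  then show ?case using qdim_Suc_upper[of n] by (simp only: choose_step)
qed

text \<open>Strong induction: the known dimensions in degrees \<open>k\<close> and \<open>k + 1\<close> attain the upper bound, which is
  what the lower bound in degree \<open>k + 3\<close> needs.\<close>

lemma qdim_eq_choose: "qdim n = (n + 2) choose 2"
proof (induction n rule: less_induct)
  case (less n)
  consider "n = 0" | "n = 1" | "n = 2" | k where "n = Suc (Suc (Suc k))"
    by (metis One_nat_def Suc_1 nat.exhaust)
  then show ?case
  proof cases
    case 1
    then show ?thesis by (simp add: qdim_0 numeral_2_eq_2)
  next
    case 2
    then show ?thesis using qdim_1 by (simp add: choose_two)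
  next
    case 3
    then show ?thesis using qdim_2 qdim_upper[of 2] by (simp add: choose_two)
  next
    case 4
    have IH: "qdim k = (k + 2) choose 2" "qdim (Suc k) = (Suc k + 2) choose 2"
      "qdim (Suc (Suc k)) = (Suc (Suc k) + 2) choose 2"
      by (rule less.IH, simp add: 4)+
    note c = choose_step[of k] choose_step[of "Suc k"] choose_step[of "Suc (Suc k)"]
    have "qdim (Suc k) = qdim k + Suc (Suc k)" unfolding IH c ..
    from qdim_lower_step[OF this] have "((Suc (Suc (Suc k)) + 2) choose 2) \<le> qdim (Suc (Suc (Suc k)))"
      unfolding IH c by simp
    then show ?thesis using qdim_upper[of n] unfolding 4 by (rule order.antisym[rotated])
  qed
qed

end


section \<open>Extension of scalars\<close>

definition scalar_ext :: "'k::field free3 \<Rightarrow> 'k alg_closure free3"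
  where "scalar_ext f = Poly_Mapping.map to_ac f"

lemma lookup_scalar_ext [simp]: "Poly_Mapping.lookup (scalar_ext f) w = to_ac (Poly_Mapping.lookup f w)"
  by (simp add: scalar_ext_def map.rep_eq when_def)

lemma scalar_ext_zero: "scalar_ext 0 = 0"
  by (rule poly_mapping_eqI) simp

lemma scalar_ext_add: "scalar_ext (f + g) = scalar_ext f + scalar_ext g"
  by (rule poly_mapping_eqI) (simp add: lookup_add)

lemma scalar_ext_smul: "scalar_ext (smul c f) = smul (to_ac c) (scalar_ext f)"
  by (rule poly_mapping_eqI) simp

lemma scalar_ext_word: "scalar_ext (word w) = word w"
  by (rule poly_mapping_eqI) (simp add: word_def lookup_single when_def)

lemma scalar_ext_word_mult: "scalar_ext (word v * g) = word v * scalar_ext g"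
  by (induction g rule: free_induct)
    (simp_all add: scalar_ext_zero scalar_ext_add scalar_ext_smul scalar_ext_word word_mult distrib_left)

lemma scalar_ext_mult: "scalar_ext (f * g) = scalar_ext f * scalar_ext g"
  by (induction f rule: free_induct)
    (simp_all add: scalar_ext_zero scalar_ext_add scalar_ext_smul scalar_ext_word scalar_ext_word_mult distrib_right)

lemma scalar_ext_var: "scalar_ext (var i) = var i"
  by (simp add: var_word scalar_ext_word)

lemma scalar_ext_sum: "scalar_ext (sum F A) = (\<Sum>x\<in>A. scalar_ext (F x))"
  by (induction A rule: infinite_finite_induct) (simp_all add: scalar_ext_zero scalar_ext_add)

lemma scalar_ext_form2: "scalar_ext (form2 M) = form2 (\<lambda>j k. to_ac (M j k))"
  by (simp add: form2_def lin_def scalar_ext_sum scalar_ext_mult scalar_ext_var scalar_ext_smul)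

lemma relation_multiples_scalar_ext: "relation_multiples (\<lambda>i. scalar_ext (r i)) n = scalar_ext ` relation_multiples r n"
proof (induction n rule: induct_nat_012)
  case (ge2 n)
  have w: "words n = scalar_ext ` words n" by (simp add: words_def image_image scalar_ext_word)
  have "(*) (scalar_ext (r i)) ` words n = scalar_ext ` (*) (r i) ` words n" for i
    by (subst w) (simp add: image_image scalar_ext_mult)
  moreover have "(*) (var i) ` scalar_ext ` relation_multiples r (Suc n)
      = scalar_ext ` (*) (var i) ` relation_multiples r (Suc n)" for i
    by (simp add: image_image scalar_ext_mult scalar_ext_var)
  ultimately show ?case by (simp add: ge2.IH image_Un image_UN)
qed simp_all

text \<open>The closure is a vector space over the ground field; linear functionals to the ground field
  turn relations with coefficients in the closure into relations over the ground field.\<close>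

lemma separating_functional:
  fixes x :: "'k::field alg_closure"
  assumes "x \<noteq> 0"
  obtains \<phi> :: "'k alg_closure \<Rightarrow> 'k"
  where "\<And>x y. \<phi> (x + y) = \<phi> x + \<phi> y" "\<And>c x. \<phi> (to_ac c * x) = c * \<phi> x" "\<phi> x = 1"
proof -
  interpret acv: vector_space_pair
    "\<lambda>(c :: 'k) x. to_ac c * x" "(*) :: 'k \<Rightarrow> 'k \<Rightarrow> 'k"
    by unfold_locales (simp_all add: algebra_simps)
  have "acv.vs1.independent {x}" using assms by simp
  then obtain \<phi> :: "'k alg_closure \<Rightarrow> 'k"
    where \<phi>: "Vector_Spaces.linear (\<lambda>c x. to_ac c * x) (*) \<phi>" "\<phi> x = 1"
    using acv.linear_independent_extend[of "{x}" "\<lambda>_. 1"] by auto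
  interpret l: Vector_Spaces.linear "\<lambda>c x. to_ac c * x" "(*)" \<phi> by (rule \<phi>(1))
  show ?thesis by (rule that[of \<phi>]) (simp_all add: l.add l.scale \<phi>(2))
qed

lemma scalar_ext_inj: "scalar_ext f = scalar_ext g \<longleftrightarrow> f = g"
  by (metis lookup_scalar_ext poly_mapping_eqI to_ac_eq_iff)

lemma independent_scalar_ext:
  assumes "finite B" "fv.independent (B :: 'k::field free3 set)"
  shows "fv.independent (scalar_ext ` B)"
proof (rule fv.independent_if_scalars_zero)
  show "finite (scalar_ext ` B)" using assms(1) by simp
  fix u x assume u: "(\<Sum>x\<in>scalar_ext ` B. smul (u x) x) = 0" and x: "x \<in> scalar_ext ` B"
  obtain b where b: "b \<in> B" "x = scalar_ext b" using x by blast
  show "u x = 0"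
  proof (rule ccontr)
    assume "u x \<noteq> 0"
    then obtain \<phi> :: "'k alg_closure \<Rightarrow> 'k"
      where \<phi>: "\<And>x y. \<phi> (x + y) = \<phi> x + \<phi> y" "\<And>c x. \<phi> (to_ac c * x) = c * \<phi> x" "\<phi> (u x) = 1"
      by (rule separating_functional) blast
    have \<phi>0: "\<phi> 0 = 0" using \<phi>(2)[of 0 0] by simp
    have \<phi>_sum: "\<phi> (sum F B) = (\<Sum>b\<in>B. \<phi> (F b))" for F
      using assms(1) by (induction B rule: finite_induct) (simp_all add: \<phi>0 \<phi>(1))
    have "(\<Sum>b\<in>B. smul (\<phi> (u (scalar_ext b))) b) = 0"
    proof (rule poly_mapping_eqI)
      fix w
      have "(\<Sum>b\<in>B. smul (u (scalar_ext b)) (scalar_ext b)) = 0"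
        using u by (subst (asm) sum.reindex) (auto simp: inj_on_def scalar_ext_inj)
      then have "(\<Sum>b\<in>B. u (scalar_ext b) * to_ac (Poly_Mapping.lookup b w)) = 0"
        by (drule_tac arg_cong[of _ _ "\<lambda>f. Poly_Mapping.lookup f w"]) (simp add: lookup_sum)
      then have "\<phi> (\<Sum>b\<in>B. to_ac (Poly_Mapping.lookup b w) * u (scalar_ext b)) = 0"
        using \<phi>0 by (simp add: mult.commute)
      then have "(\<Sum>b\<in>B. Poly_Mapping.lookup b w * \<phi> (u (scalar_ext b))) = 0"
        unfolding \<phi>_sum \<phi>(2) .
      then show "Poly_Mapping.lookup (\<Sum>b\<in>B. smul (\<phi> (u (scalar_ext b))) b) w = Poly_Mapping.lookup 0 w"
        by (simp add: lookup_sum mult.commute)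
    qed
    then have "\<phi> (u (scalar_ext b)) = 0"
      by (rule fv.independentD[OF assms(2,1) order_refl _ b(1)])
    then show False using \<phi>(3) b(2) by simp
  qed
qed

lemma dim_span_scalar_ext:
  assumes "finite (G :: 'k::field free3 set)"
  shows "fv.dim (fv.span (scalar_ext ` G)) = fv.dim (fv.span G)"
proof -
  obtain B where B: "B \<subseteq> G" "fv.independent B" "G \<subseteq> fv.span B" "card B = fv.dim G"
    by (rule fv.basis_exists)
  have fin: "finite B" using B(1) assms finite_subset by blast
  have "scalar_ext f \<in> fv.span (scalar_ext ` B)" if "f \<in> fv.span B" for f
    using that
    by (induction rule: fv.span_induct_alt)
      (auto simp: scalar_ext_zero scalar_ext_add scalar_ext_smul intro: fv.span_zero fv.span_add fv.span_scale fv.span_base)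
  then have "fv.span (scalar_ext ` B) = fv.span (scalar_ext ` G)"
    using B(1,3) by (auto simp: fv.span_eq intro: fv.span_base)
  then have "fv.dim (fv.span (scalar_ext ` G)) = card (scalar_ext ` B)"
    using fv.dim_span_eq_card_independent[OF independent_scalar_ext[OF fin B(2)]] by simp
  also have "\<dots> = card B" by (rule card_image) (auto simp: inj_on_def scalar_ext_inj)
  finally show ?thesis using B(4) by simp
qed

lemma dims_scalar_ext:
  assumes "quadratic_relations r"
  shows "quadratic_relations.qdim (\<lambda>i. scalar_ext (r i)) n = quadratic_relations.qdim r n"
proof -
  have "scalar_ext (r i) \<in> hom_part 2" for i
    using quadratic_relations.quadratic[OF assms, of i] by (simp add: hom_part_iff)
  then have e: "quadratic_relations (\<lambda>i. scalar_ext (r i))" by (rule quadratic_relations.intro)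
  show ?thesis
    using dim_span_scalar_ext[OF finite_relation_multiples, of r n]
    by (simp add: quadratic_relations.qdim_def[OF assms] quadratic_relations.qdim_def[OF e]
        quadratic_relations.I_span[OF assms] quadratic_relations.I_span[OF e]
        relation_multiples_scalar_ext)
qed


section \<open>Elements of degree three\<close>

lemma lookup_word: "Poly_Mapping.lookup (word v) w = (if v = w then 1 else 0)"
  by (simp add: word_def lookup_single when_def)

lemma lookup_var_mult: "Poly_Mapping.lookup (var i * f) (j # w) = (if j = i then Poly_Mapping.lookup f w else 0)"
  by (induction f rule: free_induct)
    (simp_all add: var_word word_mult lookup_add distrib_left lookup_word)

lemma lookup_mult_var: "Poly_Mapping.lookup (f * var i) (w @ [j]) = (if j = i then Poly_Mapping.lookup f w else 0)"
  by (induction f rule: free_induct)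
    (simp_all add: var_word word_mult lookup_add distrib_right lookup_word)

lemma lookup_lin_mult: "Poly_Mapping.lookup (lin c * f) (j # w) = c j * Poly_Mapping.lookup f w"
  by (cases j) (simp_all add: lin_def sum_gen3 distrib_right lookup_add lookup_var_mult)

lemma lookup_mult_lin: "Poly_Mapping.lookup (f * lin c) (w @ [j]) = c j * Poly_Mapping.lookup f w"
  by (cases j) (simp_all add: lin_def sum_gen3 distrib_left lookup_add lookup_mult_var)

lemma lookup_lin: "Poly_Mapping.lookup (lin c) [j] = c j"
  using lookup_lin_mult[of c 1 j "[]"] by (simp add: lookup_one zero_list_def)

lemma lookup_form2: "Poly_Mapping.lookup (form2 M) [j, k] = M j k"
  by (cases j) (simp_all add: form2_def sum_gen3 lookup_add lookup_var_mult lookup_lin)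

lemma lookup_degree_three:
  shows "Poly_Mapping.lookup (lin c * form2 M) [j, k, h] = c j * M k h"
    and "Poly_Mapping.lookup (form2 M * lin c) [j, k, h] = M j k * c h"
  using lookup_mult_lin[of "form2 M" c "[j, k]" h]
  by (simp_all add: lookup_lin_mult lookup_form2)

lemma degree_three_eqI:
  assumes "f \<in> hom_part 3" "g \<in> hom_part 3"
    "\<And>j k h. Poly_Mapping.lookup f [j, k, h] = Poly_Mapping.lookup g [j, k, h]"
  shows "f = g"
proof (rule poly_mapping_eqI)
  fix w :: "gen3 list"
  show "Poly_Mapping.lookup f w = Poly_Mapping.lookup g w"
  proof (cases "length w = 3")
    case True
    then obtain j k h where "w = [j, k, h]" by (auto simp: numeral_3_eq_3 length_Suc_conv)
    then show ?thesis using assms(3) by simp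
  next
    case False
    then show ?thesis using assms(1,2) by (simp add: hom_part_iff)
  qed
qed

lemma degree_three_closed: "lin c * form2 M \<in> hom_part 3" "form2 M * lin c \<in> hom_part 3"
  using hom_part_mult[OF lin_in_hom_part form2_hom_part, of c M]
    hom_part_mult[OF form2_hom_part lin_in_hom_part, of M c] by (simp_all add: numeral_3_eq_3 numeral_2_eq_2)

text \<open>Elements of degree three are determined by their coefficients, which turns the equation for a
  superpotential into one between the coefficients of the relations.\<close>

lemma overlap_iff:
  "(\<Sum>i\<in>UNIV. form2 (T i) * lin (l i)) = (\<Sum>i\<in>UNIV. lin (m i) * form2 (T i)) \<longleftrightarrow>
    (\<forall>j k h. (\<Sum>i\<in>UNIV. T i j k * l i h) = (\<Sum>i\<in>UNIV. m i j * T i k h))"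
  (is "?F = ?G \<longleftrightarrow> ?C")
proof
  assume "?F = ?G"
  then have "Poly_Mapping.lookup ?F [j, k, h] = Poly_Mapping.lookup ?G [j, k, h]" for j k h by simp
  then show ?C by (simp add: lookup_sum lookup_degree_three)
next
  assume ?C
  then show "?F = ?G"
    by (intro degree_three_eqI fv.subspace_sum[OF hom_part_subspace] degree_three_closed)
      (simp add: lookup_sum lookup_degree_three)
qed


section \<open>Points of the determinantal cubic\<close>

text \<open>The points of the line other than \<open>(1, 0, w)\<close> are \<open>(s, 1, w s + r)\<close>. The value of the cubic at
  \<open>(1, 0, w)\<close> is the coefficient of \<open>s\<^sup>3\<close> in its value at \<open>(s, 1, w s + r)\<close>, so either it vanishes or
  the latter is a nonconstant polynomial in \<open>s\<close>.\<close>

lemma cubic_root_on_line: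
  fixes u1 :: "'k::alg_closed_field"
  assumes "u3 \<noteq> 0"
  shows "\<exists>p1 p2 p3. (p1 \<noteq> 0 \<or> p2 \<noteq> 0 \<or> p3 \<noteq> 0) \<and> u1 * p1 + u2 * p2 + u3 * p3 = 0 \<and>
    A1 * p1 ^ 3 + A2 * p2 ^ 3 + A3 * p3 ^ 3 + B * (p1 * p2 * p3) = 0"
proof -
  define r where "r = - u2 / u3"
  define w where "w = - u1 / u3"
  have line: "u1 * s + u2 * t + u3 * (w * s + r * t) = 0" for s t
  proof -
    have "u3 * w = - u1" "u3 * r = - u2" using assms by (simp_all add: w_def r_def)
    then show ?thesis by (simp add: distrib_left flip: mult.assoc)
  qed
  show ?thesis
  proof (cases "A1 + A3 * w ^ 3 = 0")
    case True
    show ?thesis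
    proof (intro exI conjI)
      show "1 \<noteq> (0 :: 'k) \<or> 0 \<noteq> (0 :: 'k) \<or> w \<noteq> 0" by simp
      show "u1 * 1 + u2 * 0 + u3 * w = 0" using line[of 1 0] by simp
      show "A1 * 1 ^ 3 + A2 * 0 ^ 3 + A3 * w ^ 3 + B * (1 * 0 * w) = 0" using True by simp
    qed
  next
    case False
    define P where "P = [:A2 + A3 * r ^ 3, 3 * A3 * r ^ 2 * w + B * r, 3 * A3 * r * w ^ 2 + B * w, A1 + A3 * w ^ 3:]"
    have "degree P > 0" using False by (simp add: P_def)
    from alg_closed_imp_poly_has_root[OF this] obtain s where s: "poly P s = 0" by (rule exE)
    have "poly P s = A1 * s ^ 3 + A2 * 1 ^ 3 + A3 * (w * s + r * 1) ^ 3 + B * (s * 1 * (w * s + r * 1))"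
      by (simp add: P_def algebra_simps power2_eq_square power3_eq_cube)
    with s have "A1 * s ^ 3 + A2 * 1 ^ 3 + A3 * (w * s + r * 1) ^ 3 + B * (s * 1 * (w * s + r * 1)) = 0"
      by simp
    moreover have "s \<noteq> 0 \<or> 1 \<noteq> (0 :: 'k) \<or> w * s + r * 1 \<noteq> 0" by simp
    ultimately show ?thesis using line[of s 1] by blast
  qed
qed

lemma cubic_meets_line:
  fixes u :: "gen3 \<Rightarrow> 'k::alg_closed_field"
  assumes "u i \<noteq> 0"
  obtains p j where "p j \<noteq> 0" "dot u p = 0"
    "(\<Sum>i\<in>UNIV. A i * p i ^ 3) + B * (p GX * p GY * p GZ) = 0"
proof -
  have "\<exists>p. (p GX \<noteq> 0 \<or> p GY \<noteq> 0 \<or> p GZ \<noteq> 0) \<and> dot u p = 0 \<and>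
      (\<Sum>i\<in>UNIV. A i * p i ^ 3) + B * (p GX * p GY * p GZ) = 0"
  proof (cases i)
    case GX
    then have "u GX \<noteq> 0" using assms by simp
    from cubic_root_on_line[OF this, of "u GY" "u GZ" "A GY" "A GZ" "A GX" B]
    obtain p1 p2 p3 where "p1 \<noteq> 0 \<or> p2 \<noteq> 0 \<or> p3 \<noteq> 0" "u GY * p1 + u GZ * p2 + u GX * p3 = 0"
      "A GY * p1 ^ 3 + A GZ * p2 ^ 3 + A GX * p3 ^ 3 + B * (p1 * p2 * p3) = 0"
      by (elim exE conjE) (rule that)
    then show ?thesis
      by (intro exI[of _ "case_gen3 p3 p1 p2"] conjI) (auto simp: dot_def sum_gen3 add_ac mult_ac)
  next
    case GY
    then have "u GY \<noteq> 0" using assms by simp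
    from cubic_root_on_line[OF this, of "u GZ" "u GX" "A GZ" "A GX" "A GY" B]
    obtain p1 p2 p3 where "p1 \<noteq> 0 \<or> p2 \<noteq> 0 \<or> p3 \<noteq> 0" "u GZ * p1 + u GX * p2 + u GY * p3 = 0"
      "A GZ * p1 ^ 3 + A GX * p2 ^ 3 + A GY * p3 ^ 3 + B * (p1 * p2 * p3) = 0"
      by (elim exE conjE) (rule that)
    then show ?thesis
      by (intro exI[of _ "case_gen3 p2 p3 p1"] conjI) (auto simp: dot_def sum_gen3 add_ac mult_ac)
  next
    case GZ
    then have "u GZ \<noteq> 0" using assms by simp
    from cubic_root_on_line[OF this, of "u GX" "u GY" "A GX" "A GY" "A GZ" B]
    obtain p1 p2 p3 where "p1 \<noteq> 0 \<or> p2 \<noteq> 0 \<or> p3 \<noteq> 0" "u GX * p1 + u GY * p2 + u GZ * p3 = 0"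
      "A GX * p1 ^ 3 + A GY * p2 ^ 3 + A GZ * p3 ^ 3 + B * (p1 * p2 * p3) = 0"
      by (elim exE conjE) (rule that)
    then show ?thesis
      by (intro exI[of _ "case_gen3 p1 p2 p3"] conjI) (auto simp: dot_def sum_gen3 add_ac mult_ac)
  qed
  then show ?thesis using that by blast
qed

text \<open>The columns of the adjugate of a singular matrix with rows \<open>M i\<close> lie in its left kernel.\<close>

lemma left_kernel_of_cofactor:
  assumes det: "dot (M GX) (cross (M GY) (M GZ)) = 0" and cof: "cross (M i) (M i') k \<noteq> 0"
  shows "\<exists>t. (\<exists>j. t j \<noteq> 0) \<and> (\<forall>h. (\<Sum>i\<in>UNIV. t i * M i h) = (0 :: 'k::field))"
proof -
  let ?t = "case_gen3 (cross (M GY) (M GZ) k) (cross (M GZ) (M GX) k) (cross (M GX) (M GY) k)"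
  have "\<exists>j. ?t j \<noteq> 0"
    using cof by (cases i; cases i'; cases k; auto simp: ex_gen3 cross_def algebra_simps)
  moreover have "(\<Sum>i\<in>UNIV. ?t i * M i h) = 0" for h
    using det by (cases k; cases h; simp add: sum_gen3 cross_def dot_def algebra_simps)
  ultimately show ?thesis by blast
qed


section \<open>The generalized Sklyanin relations\<close>

text \<open>The entry at \<open>i\<close>, \<open>j\<close>, \<open>k\<close> is the coefficient of the word \<open>j k\<close> in the relation \<open>i\<close>.\<close>

definition sklyanin :: "'k::field \<Rightarrow> 'k \<Rightarrow> 'k \<Rightarrow> 'k \<Rightarrow> 'k \<Rightarrow> 'k \<Rightarrow> gen3 \<Rightarrow> gen3 \<Rightarrow> gen3 \<Rightarrow> 'k"
  where "sklyanin a b c \<alpha> \<beta> \<gamma> = case_gen3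
    (case_gen3 (case_gen3 (- \<alpha>) 0 0) (case_gen3 0 0 1) (case_gen3 0 (- a) 0))
    (case_gen3 (case_gen3 0 0 (- b)) (case_gen3 0 (- \<beta>) 0) (case_gen3 1 0 0))
    (case_gen3 (case_gen3 0 1 0) (case_gen3 (- c) 0 0) (case_gen3 0 0 (- \<gamma>)))"

lemma S_rels_eq_range: "S_rels a b c \<alpha> \<beta> \<gamma> = range (\<lambda>i. form2 (sklyanin a b c \<alpha> \<beta> \<gamma> i))"
proof -
  have "form2 (sklyanin a b c \<alpha> \<beta> \<gamma> GX) = var GY * var GZ - scal a * var GZ * var GY - scal \<alpha> * var GX * var GX"
    "form2 (sklyanin a b c \<alpha> \<beta> \<gamma> GY) = var GZ * var GX - scal b * var GX * var GZ - scal \<beta> * var GY * var GY"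
    "form2 (sklyanin a b c \<alpha> \<beta> \<gamma> GZ) = var GX * var GY - scal c * var GY * var GX - scal \<gamma> * var GZ * var GZ"
    by (simp_all add: form2_def lin_def sum_gen3 sklyanin_def algebra_simps smul_def[symmetric] mult.assoc)
  then show ?thesis
    by (auto simp: S_rels_def Let_def UNIV_gen3)
qed

text \<open>Three of the two by two minors of the matrix with rows \<open>r\<^sub>i(p, _)\<close>, at a common zero with nonzero
  first coordinate. The cyclic symmetry of the relations takes care of the other coordinates, and up
  to the order of \<open>a\<close>, \<open>b\<close>, \<open>c\<close> the same equations describe the combinations of the relations that are
  pure tensors.\<close>

lemma minors_vanish:
  fixes a b c :: "'k::field"
  assumes nz: "\<alpha> * \<beta> * \<gamma> \<noteq> 0" and p: "p1 \<noteq> 0"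
    and "\<alpha> * b * p1\<^sup>2 = p2 * p3" "\<beta> * \<gamma> * (p2 * p3) + b * p1\<^sup>2 = 0" "\<alpha> * p1\<^sup>2 + a * c * (p2 * p3) = 0"
  shows "a * b * c = -1 \<and> \<alpha> * \<beta> * \<gamma> = -1"
proof -
  have "\<alpha> * p1\<^sup>2 * (1 + a * b * c) = 0"
    using assms(5) unfolding assms(3)[symmetric] by (simp add: algebra_simps)
  then have abc: "1 + a * b * c = 0" using nz p by simp
  have "b * p1\<^sup>2 * (1 + \<alpha> * \<beta> * \<gamma>) = 0"
    using assms(4) unfolding assms(3)[symmetric] by (simp add: algebra_simps)
  moreover have "b \<noteq> 0" using abc by auto
  ultimately have "1 + \<alpha> * \<beta> * \<gamma> = 0" using p by simp
  with abc show ?thesis by (simp add: add_eq_0_iff)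
qed


lemma row_sklyanin:
  fixes a b c \<alpha> \<beta> \<gamma> :: "'k::field"
  defines "row \<equiv> bilinear_relations.row (sklyanin a b c \<alpha> \<beta> \<gamma>)"
  shows "row p GX = case_gen3 (- \<alpha> * p GX) (- a * p GZ) (p GY)"
    and "row p GY = case_gen3 (p GZ) (- \<beta> * p GY) (- b * p GX)"
    and "row p GZ = case_gen3 (- c * p GY) (p GX) (- \<gamma> * p GZ)"
  unfolding row_def bilinear_relations.row_def
  by (auto simp: sum_gen3 sklyanin_def fun_eq_iff all_gen3)

context
  fixes a b c \<alpha> \<beta> \<gamma> :: "'k::field"
  assumes nz: "\<alpha> * \<beta> * \<gamma> \<noteq> 0" and nd: "\<not> (a * b * c = -1 \<and> \<alpha> * \<beta> * \<gamma> = -1)"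
begin

interpretation bilinear_relations "sklyanin a b c \<alpha> \<beta> \<gamma>" .

lemma sklyanin_rank:
  assumes "p j \<noteq> 0"
  shows "\<exists>i i' k. cross (row p i) (row p i') k \<noteq> 0"
proof (rule ccontr)
  assume "\<nexists>i i' k. cross (row p i) (row p i') k \<noteq> 0"
  then have *: "cross (row p i) (row p i') k = 0" for i i' k by blast
  have X: "\<alpha> * b * (p GX)\<^sup>2 = p GY * p GZ" "\<beta> * \<gamma> * (p GY * p GZ) + b * (p GX)\<^sup>2 = 0"
    "\<alpha> * (p GX)\<^sup>2 + a * c * (p GY * p GZ) = 0"
    using *[of GX GY GY] *[of GY GZ GX] *[of GX GZ GZ]
    by (simp_all add: row_sklyanin cross_def power2_eq_square algebra_simps add_eq_0_iff)
  have Y: "\<beta> * c * (p GY)\<^sup>2 = p GZ * p GX" "\<gamma> * \<alpha> * (p GZ * p GX) + c * (p GY)\<^sup>2 = 0"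
    "\<beta> * (p GY)\<^sup>2 + b * a * (p GZ * p GX) = 0"
    using *[of GY GZ GZ] *[of GX GZ GY] *[of GX GY GX]
    by (simp_all add: row_sklyanin cross_def power2_eq_square algebra_simps add_eq_0_iff)
  have Z: "\<gamma> * a * (p GZ)\<^sup>2 = p GX * p GY" "\<alpha> * \<beta> * (p GX * p GY) + a * (p GZ)\<^sup>2 = 0"
    "\<gamma> * (p GZ)\<^sup>2 + c * b * (p GX * p GY) = 0"
    using *[of GX GZ GX] *[of GX GY GZ] *[of GY GZ GY]
    by (simp_all add: row_sklyanin cross_def power2_eq_square algebra_simps add_eq_0_iff)
  show False
  proof (cases j)
    case GX
    with assms have "p GX \<noteq> 0" by simp
    from minors_vanish[OF nz this X] nd show False by simp
  next
    case GY
    have "\<beta> * \<gamma> * \<alpha> \<noteq> 0" using nz by simp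
    moreover from GY assms have "p GY \<noteq> 0" by simp
    ultimately have "b * c * a = -1 \<and> \<beta> * \<gamma> * \<alpha> = -1" using Y by (rule minors_vanish)
    then show False using nd by (simp add: mult_ac)
  next
    case GZ
    have "\<gamma> * \<alpha> * \<beta> \<noteq> 0" using nz by simp
    moreover from GZ assms have "p GZ \<noteq> 0" by simp
    ultimately have "c * a * b = -1 \<and> \<gamma> * \<alpha> * \<beta> = -1" using Z by (rule minors_vanish)
    then show False using nd by (simp add: mult_ac)
  qed
qed

lemma sklyanin_no_pure_tensor:
  assumes t: "t i \<noteq> 0"
  shows "(\<lambda>j k. \<Sum>i\<in>UNIV. t i * sklyanin a b c \<alpha> \<beta> \<gamma> i j k) \<noteq> (\<lambda>j k. g k * u j)"
proof
  define M where "M = (\<lambda>j k. \<Sum>i\<in>UNIV. t i * sklyanin a b c \<alpha> \<beta> \<gamma> i j k)"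
  assume "(\<lambda>j k. \<Sum>i\<in>UNIV. t i * sklyanin a b c \<alpha> \<beta> \<gamma> i j k) = (\<lambda>j k. g k * u j)"
  then have "M = (\<lambda>j k. g k * u j)" by (simp add: M_def)
  then have *: "M j k * M j' k' = M j k' * M j' k" for j k j' k' by simp
  have M: "M GX GX = - \<alpha> * t GX" "M GX GY = t GZ" "M GX GZ = - b * t GY"
    "M GY GX = - c * t GZ" "M GY GY = - \<beta> * t GY" "M GY GZ = t GX"
    "M GZ GX = t GY" "M GZ GY = - a * t GX" "M GZ GZ = - \<gamma> * t GZ"
    by (simp_all add: M_def sum_gen3 sklyanin_def)
  have X: "\<alpha> * a * (t GX)\<^sup>2 = t GY * t GZ" "\<beta> * \<gamma> * (t GY * t GZ) + a * (t GX)\<^sup>2 = 0"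
    "\<alpha> * (t GX)\<^sup>2 + b * c * (t GY * t GZ) = 0"
    using *[of GX GX GZ GY] *[of GY GY GZ GZ] *[of GX GX GY GZ]
    by (simp_all add: M power2_eq_square algebra_simps add_eq_0_iff)
  have Y: "\<beta> * b * (t GY)\<^sup>2 = t GZ * t GX" "\<gamma> * \<alpha> * (t GZ * t GX) + b * (t GY)\<^sup>2 = 0"
    "\<beta> * (t GY)\<^sup>2 + c * a * (t GZ * t GX) = 0"
    using *[of GX GY GY GZ] *[of GX GX GZ GZ] *[of GY GX GZ GY]
    by (simp_all add: M power2_eq_square algebra_simps add_eq_0_iff)
  have Z: "\<gamma> * c * (t GZ)\<^sup>2 = t GX * t GY" "\<alpha> * \<beta> * (t GX * t GY) + c * (t GZ)\<^sup>2 = 0"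
    "\<gamma> * (t GZ)\<^sup>2 + a * b * (t GX * t GY) = 0"
    using *[of GY GX GZ GZ] *[of GX GX GY GY] *[of GX GY GZ GZ]
    by (simp_all add: M power2_eq_square algebra_simps add_eq_0_iff)
  show False
  proof (cases i)
    case GX
    with t have "t GX \<noteq> 0" by simp
    from minors_vanish[OF nz this X] nd show False by (simp add: mult_ac)
  next
    case GY
    have "\<beta> * \<gamma> * \<alpha> \<noteq> 0" using nz by simp
    moreover from GY t have "t GY \<noteq> 0" by simp
    ultimately have "c * b * a = -1 \<and> \<beta> * \<gamma> * \<alpha> = -1" using Y by (rule minors_vanish)
    then show False using nd by (simp add: mult_ac)
  next
    case GZ
    have "\<gamma> * \<alpha> * \<beta> \<noteq> 0" using nz by simp
    moreover from GZ t have "t GZ \<noteq> 0" by simp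
    ultimately have "a * c * b = -1 \<and> \<gamma> * \<alpha> * \<beta> = -1" using Z by (rule minors_vanish)
    then show False using nd by (simp add: mult_ac)
  qed
qed

end

text \<open>The determinant of the matrix with rows \<open>r\<^sub>i(p, _)\<close> is a combination of the cubes of the coordinates
  and of their product, and has a zero on every line over an algebraically closed field.\<close>

lemma sklyanin_nondegenerate:
  fixes a b c \<alpha> \<beta> \<gamma> :: "'k::alg_closed_field"
  assumes nz: "\<alpha> * \<beta> * \<gamma> \<noteq> 0" and nd: "\<not> (a * b * c = -1 \<and> \<alpha> * \<beta> * \<gamma> = -1)"
  shows "nondegenerate_relations (sklyanin a b c \<alpha> \<beta> \<gamma>)"
proof
  interpret bilinear_relations "sklyanin a b c \<alpha> \<beta> \<gamma>" .
  show "\<exists>i i' k. cross (row p i) (row p i') k \<noteq> 0" if "p j \<noteq> 0" for p j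
    using sklyanin_rank[OF nz nd, of p j] that by blast
  show "(\<lambda>j k. \<Sum>i\<in>UNIV. t i * sklyanin a b c \<alpha> \<beta> \<gamma> i j k) \<noteq> (\<lambda>j k. g k * u j)" if "t i \<noteq> 0" for t i g u
    using sklyanin_no_pure_tensor[OF nz nd, of t i] that by blast
  show "\<exists>p t. (\<exists>j. p j \<noteq> 0) \<and> dot u p = 0 \<and> (\<exists>j. t j \<noteq> 0) \<and> (\<forall>k. (\<Sum>i\<in>UNIV. t i * row p i k) = 0)"
    if u: "u i \<noteq> 0" for u i
  proof -
    obtain p j where p: "p j \<noteq> 0" "dot u p = 0"
      "(\<Sum>i\<in>UNIV. case_gen3 (- \<alpha> * b) (- \<beta> * c) (- a * \<gamma>) i * p i ^ 3)
        + (1 - \<alpha> * \<beta> * \<gamma> - a * b * c) * (p GX * p GY * p GZ) = 0"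
      by (rule cubic_meets_line[of u i "case_gen3 (- \<alpha> * b) (- \<beta> * c) (- a * \<gamma>)"
            "1 - \<alpha> * \<beta> * \<gamma> - a * b * c", OF u])
    have "dot (row p GX) (cross (row p GY) (row p GZ)) = 0"
      using p(3) by (simp add: row_sklyanin dot_def cross_def sum_gen3 power3_eq_cube algebra_simps)
    moreover obtain i1 i2 k where "cross (row p i1) (row p i2) k \<noteq> 0"
      using sklyanin_rank[OF nz nd, of p j, OF p(1)] by blast
    ultimately have "\<exists>t. (\<exists>j. t j \<noteq> 0) \<and> (\<forall>k. (\<Sum>i\<in>UNIV. t i * row p i k) = 0)"
      by (rule left_kernel_of_cofactor)
    then show ?thesis using p(1,2) by blast
  qed
qed

text \<open>The alternatives correspond to superpotentials of degree \<open>0\<close>, \<open>1\<close> and \<open>2\<close> for the grading by integers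
  modulo three in which \<open>x\<close>, \<open>y\<close>, \<open>z\<close> have degrees \<open>0\<close>, \<open>1\<close>, \<open>2\<close>.\<close>

definition superpotential_condition :: "'k::field \<Rightarrow> 'k \<Rightarrow> 'k \<Rightarrow> 'k \<Rightarrow> 'k \<Rightarrow> 'k \<Rightarrow> bool"
  where "superpotential_condition a b c \<alpha> \<beta> \<gamma> \<longleftrightarrow> a = b \<and> b = c
    \<or> a\<^sup>2 * b = -1 \<and> b\<^sup>2 * c = -1 \<and> c\<^sup>2 * a = -1 \<and> a * b * c * (\<alpha> * \<beta> * \<gamma>) = 1
    \<or> a\<^sup>2 * c = -1 \<and> c\<^sup>2 * b = -1 \<and> b\<^sup>2 * a = -1 \<and> a * b * c * (\<alpha> * \<beta> * \<gamma>) = 1"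

text \<open>Here \<open>x r\<^sub>1 + y r\<^sub>2 + z r\<^sub>3 = r\<^sub>1 x + r\<^sub>2 y + r\<^sub>3 z\<close>.\<close>

lemma cubic_overlap_degree_0:
  fixes a :: "'k::field"
  assumes "a = b" "b = c"
  shows "(\<Sum>i\<in>UNIV. sklyanin a b c \<alpha> \<beta> \<gamma> i j k * (if h = i then 1 else 0))
    = (\<Sum>i\<in>UNIV. (if j = i then 1 else 0) * sklyanin a b c \<alpha> \<beta> \<gamma> i k h)"
  by (cases j; cases k; cases h; simp add: sum_gen3 sklyanin_def assms)

text \<open>The common element is a combination of \<open>x r\<^sub>3\<close>, \<open>y r\<^sub>1\<close>, \<open>z r\<^sub>2\<close> and one of \<open>r\<^sub>3 x\<close>, \<open>r\<^sub>1 y\<close>, \<open>r\<^sub>2 z\<close>. With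
  coefficient \<open>1\<close> of \<open>x r\<^sub>3\<close>, comparing coefficients of words determines the other five.\<close>

lemma cubic_overlap_degree_1:
  fixes a :: "'k::field"
  assumes "\<alpha> * \<beta> * \<gamma> \<noteq> 0" "a\<^sup>2 * b = -1" "b\<^sup>2 * c = -1" "c\<^sup>2 * a = -1" "a * b * c * (\<alpha> * \<beta> * \<gamma>) = 1"
  shows "(\<Sum>i\<in>UNIV. sklyanin a b c \<alpha> \<beta> \<gamma> i j k
        * case_gen3 (case_gen3 0 (- 1 / \<alpha>) 0) (case_gen3 0 0 (\<gamma> / b)) (case_gen3 (- c) 0 0) i h)
    = (\<Sum>i\<in>UNIV. case_gen3 (case_gen3 0 (1 / (a * \<alpha>)) 0) (case_gen3 0 0 (\<gamma> * c)) (case_gen3 1 0 0) i j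
        * sklyanin a b c \<alpha> \<beta> \<gamma> i k h)"
proof -
  have nz: "\<alpha> \<noteq> 0" "\<beta> \<noteq> 0" "\<gamma> \<noteq> 0" "a \<noteq> 0" "b \<noteq> 0" "c \<noteq> 0" using assms by auto
  have 1: "\<beta> * \<gamma> * c * a * b * \<alpha> = 1" using assms(5) by (simp add: mult_ac)
  have 2: "c * b * b = -1" "a * c * c = -1" "b * a * a = -1" using assms(2-4) by (simp_all add: power2_eq_square mult_ac)
  have "b * (a * b * c * (\<alpha> * \<beta> * \<gamma>)) = (b\<^sup>2 * c) * (a * (\<alpha> * \<beta> * \<gamma>))"
    "a * (a * b * c * (\<alpha> * \<beta> * \<gamma>)) = (a\<^sup>2 * b) * (c * (\<alpha> * \<beta> * \<gamma>))"
    by (simp_all add: power2_eq_square mult_ac)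
  then have 3: "- (\<alpha> * (\<beta> * (\<gamma> * a))) = b" "a = - (\<alpha> * (\<beta> * (\<gamma> * c)))"
    unfolding assms(2,3,5) by (simp_all add: mult_ac)
  show ?thesis
    using nz 1 2 3
    by (cases j; cases k; cases h; simp add: sum_gen3 sklyanin_def field_simps; algebra)
qed

text \<open>As before, with \<open>x r\<^sub>2\<close>, \<open>y r\<^sub>3\<close>, \<open>z r\<^sub>1\<close> and \<open>r\<^sub>2 x\<close>, \<open>r\<^sub>3 y\<close>, \<open>r\<^sub>1 z\<close>, and coefficient \<open>1\<close> of \<open>x r\<^sub>2\<close>.\<close>

lemma cubic_overlap_degree_2:
  fixes a :: "'k::field"
  assumes "\<alpha> * \<beta> * \<gamma> \<noteq> 0" "a\<^sup>2 * c = -1" "c\<^sup>2 * b = -1" "b\<^sup>2 * a = -1" "a * b * c * (\<alpha> * \<beta> * \<gamma>) = 1"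
  shows "(\<Sum>i\<in>UNIV. sklyanin a b c \<alpha> \<beta> \<gamma> i j k
        * case_gen3 (case_gen3 0 0 (b / \<alpha>)) (case_gen3 (- 1 / b) 0 0) (case_gen3 0 (- \<beta>) 0) i h)
    = (\<Sum>i\<in>UNIV. case_gen3 (case_gen3 0 0 (- a * b / \<alpha>)) (case_gen3 1 0 0) (case_gen3 0 (c * \<beta>) 0) i j
        * sklyanin a b c \<alpha> \<beta> \<gamma> i k h)"
proof -
  have nz: "\<alpha> \<noteq> 0" "\<beta> \<noteq> 0" "\<gamma> \<noteq> 0" "a \<noteq> 0" "b \<noteq> 0" "c \<noteq> 0" using assms by auto
  have 2: "b * c * c = -1" "c * a * a = -1" "a * b * b = -1" using assms(2-4) by (simp_all add: power2_eq_square mult_ac)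
  have "b * (a * b * c * (\<alpha> * \<beta> * \<gamma>)) = (b\<^sup>2 * a) * (c * (\<alpha> * \<beta> * \<gamma>))"
    "a * (a * b * c * (\<alpha> * \<beta> * \<gamma>)) = (a\<^sup>2 * c) * (b * (\<alpha> * \<beta> * \<gamma>))"
    by (simp_all add: power2_eq_square mult_ac)
  then have 3: "\<alpha> * (\<beta> * (\<gamma> * c)) = - b" "\<alpha> * (\<beta> * (\<gamma> * b)) = - a"
    unfolding assms(2,4,5) by (simp_all add: mult_ac)
  have "a\<^sup>2 * (\<alpha> * (\<beta> * (\<gamma> * c))) = (a\<^sup>2 * c) * (\<alpha> * \<beta> * \<gamma>)"
    by (simp add: mult_ac)
  then have 4: "\<alpha> * (\<beta> * \<gamma>) = a * (a * b)"
    unfolding assms(2) 3(1) by (simp add: power2_eq_square mult_ac)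
  show ?thesis
    using nz 2 3 4
    by (cases j; cases k; cases h; simp add: sum_gen3 sklyanin_def field_simps; algebra)
qed

lemma superpotential_exists:
  fixes a :: "'k::field"
  assumes nz: "\<alpha> * \<beta> * \<gamma> \<noteq> 0" and sp: "superpotential_condition a b c \<alpha> \<beta> \<gamma>"
  shows "\<exists>l m i j. l i j \<noteq> 0 \<and> (\<Sum>i\<in>UNIV. form2 (sklyanin a b c \<alpha> \<beta> \<gamma> i) * lin (l i))
    = (\<Sum>i\<in>UNIV. lin (m i) * form2 (sklyanin a b c \<alpha> \<beta> \<gamma> i))"
proof -
  from sp consider "a = b" "b = c"
    | "a\<^sup>2 * b = -1" "b\<^sup>2 * c = -1" "c\<^sup>2 * a = -1" "a * b * c * (\<alpha> * \<beta> * \<gamma>) = 1"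
    | "a\<^sup>2 * c = -1" "c\<^sup>2 * b = -1" "b\<^sup>2 * a = -1" "a * b * c * (\<alpha> * \<beta> * \<gamma>) = 1"
    unfolding superpotential_condition_def by blast
  then show ?thesis
  proof cases
    case 1
    show ?thesis
      unfolding overlap_iff
      by (rule exI[of _ "\<lambda>i h. if h = i then 1 else 0"], rule exI[of _ "\<lambda>i j. if j = i then 1 else 0"],
          rule exI[of _ GX], rule exI[of _ GX], intro conjI allI cubic_overlap_degree_0 1) simp
  next
    case 2
    show ?thesis
      unfolding overlap_iff
      by (rule exI, rule exI, rule exI[of _ GX], rule exI[of _ GY], rule conjI[rotated],
          intro allI, rule cubic_overlap_degree_1[OF nz 2]) (use nz in simp)
  next
    case 3
    show ?thesis
      unfolding overlap_iff
      by (rule exI, rule exI, rule exI[of _ GZ], rule exI[of _ GY], rule conjI[rotated],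
          intro allI, rule cubic_overlap_degree_2[OF nz 3]) (use nz in simp)
  qed
qed

lemma sklyanin_quadratic: "quadratic_relations (\<lambda>i. form2 (sklyanin a b c \<alpha> \<beta> \<gamma> i))"
  by (rule quadratic_relations.intro) (rule form2_hom_part)

lemma sklyanin_dims:
  fixes a :: "'k::alg_closed_field"
  assumes nz: "\<alpha> * \<beta> * \<gamma> \<noteq> 0" and nd: "\<not> (a * b * c = -1 \<and> \<alpha> * \<beta> * \<gamma> = -1)"
    and sp: "superpotential_condition a b c \<alpha> \<beta> \<gamma>"
  shows "quadratic_relations.qdim (\<lambda>i. form2 (sklyanin a b c \<alpha> \<beta> \<gamma> i)) n = (n + 2) choose 2"
proof -
  let ?T = "sklyanin a b c \<alpha> \<beta> \<gamma>"
  obtain l m i j where lm: "l i j \<noteq> 0"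
    "(\<Sum>i\<in>UNIV. form2 (?T i) * lin (l i)) = (\<Sum>i\<in>UNIV. lin (m i) * form2 (?T i))"
    using superpotential_exists[OF nz sp] by (elim exE conjE) (rule that)
  have r: "bilinear_relations.r ?T = (\<lambda>i. form2 (?T i))"
    by (rule ext) (rule bilinear_relations.r_def)
  have "superpotential_relations ?T l m i j"
    by (rule superpotential_relations.intro[OF sklyanin_nondegenerate[OF nz nd]],
        rule superpotential_relations_axioms.intro) (use lm in \<open>simp_all add: r\<close>)
  from superpotential_relations.qdim_eq_choose[OF this] show ?thesis unfolding r .
qed

lemma sklyanin_dims_field:
  fixes a :: "'k::field"
  assumes nz: "\<alpha> * \<beta> * \<gamma> \<noteq> 0" and nd: "\<not> (a * b * c = -1 \<and> \<alpha> * \<beta> * \<gamma> = -1)"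
    and sp: "superpotential_condition a b c \<alpha> \<beta> \<gamma>"
  shows "quadratic_relations.qdim (\<lambda>i. form2 (sklyanin a b c \<alpha> \<beta> \<gamma> i)) n = (n + 2) choose 2"
proof -
  let ?L = "sklyanin (to_ac a) (to_ac b) (to_ac c) (to_ac \<alpha>) (to_ac \<beta>) (to_ac \<gamma>)"
  have m1: "to_ac x = -1 \<longleftrightarrow> x = -1" for x :: 'k
    by (metis to_ac_1 to_ac_eq_iff to_ac_minus)
  have p1: "to_ac x = 1 \<longleftrightarrow> x = 1" for x :: 'k
    by (metis to_ac_1 to_ac_eq_iff)
  have "to_ac (sklyanin a b c \<alpha> \<beta> \<gamma> i j k) = ?L i j k" for i j k
    by (cases i; cases j; cases k; simp add: sklyanin_def)
  then have e: "(\<lambda>i. scalar_ext (form2 (sklyanin a b c \<alpha> \<beta> \<gamma> i))) = (\<lambda>i. form2 (?L i))"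
    by (simp add: scalar_ext_form2)
  have "to_ac \<alpha> * to_ac \<beta> * to_ac \<gamma> \<noteq> 0" using nz by simp
  moreover have "\<not> (to_ac a * to_ac b * to_ac c = -1 \<and> to_ac \<alpha> * to_ac \<beta> * to_ac \<gamma> = -1)"
    using nd by (simp add: m1 flip: to_ac_mult)
  moreover have "superpotential_condition (to_ac a) (to_ac b) (to_ac c) (to_ac \<alpha>) (to_ac \<beta>) (to_ac \<gamma>)"
    using sp by (simp add: superpotential_condition_def m1 p1 flip: to_ac_mult to_ac_power)
  ultimately have "quadratic_relations.qdim (\<lambda>i. form2 (?L i)) n = (n + 2) choose 2"
    by (rule sklyanin_dims)
  then show ?thesis
    using dims_scalar_ext[OF sklyanin_quadratic, of a b c \<alpha> \<beta> \<gamma> n] by (simp add: e)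
qed


section \<open>Necessity: the component of degree three\<close>

text \<open>The left summand indexes the products of variables with relations, the right summand the products of
  relations with variables.\<close>

definition multiple3 :: "(gen3 \<Rightarrow> 'k::field free3) \<Rightarrow> (gen3 \<times> gen3) + (gen3 \<times> gen3) \<Rightarrow> 'k free3"
  where "multiple3 r = case_sum (\<lambda>(i, j). var j * r i) (\<lambda>(i, j). r i * var j)"

lemma relation_multiples_3: "relation_multiples r 3 = range (multiple3 r)"
proof -
  have w: "words 0 = {1}" "words 1 = range var"
    by (auto simp: words_def word_Nil var_word length_Suc_conv image_iff)
  have 2: "relation_multiples r (Suc (Suc 0)) = range r" by (auto simp: w)
  have "relation_multiples r 3 = (\<Union>j. (*) (var j) ` range r) \<union> (\<Union>i. (*) (r i) ` range var)"
    unfolding numeral_3_eq_3 relation_multiples.simps(3)[of r "Suc 0"] 2 w(2)[unfolded One_nat_def] ..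
  also have "\<dots> = range (multiple3 r)"
  proof (intro equalityI subsetI)
    fix x assume "x \<in> (\<Union>j. (*) (var j) ` range r) \<union> (\<Union>i. (*) (r i) ` range var)"
    then obtain i j where "x = multiple3 r (Inl (i, j)) \<or> x = multiple3 r (Inr (i, j))"
      by (auto simp: multiple3_def)
    then show "x \<in> range (multiple3 r)" by blast
  next
    fix x assume "x \<in> range (multiple3 r)"
    then obtain y where y: "x = multiple3 r y" by blast
    obtain i j where "y = Inl (i, j) \<or> y = Inr (i, j)" by (cases y) auto
    then have "x = var j * r i \<or> x = r i * var j" by (auto simp: y multiple3_def)
    then show "x \<in> (\<Union>j. (*) (var j) ` range r) \<union> (\<Union>i. (*) (r i) ` range var)" by blast
  qed
  finally show ?thesis .
qed

lemma sum_multiple3: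
  "(\<Sum>x\<in>UNIV. smul (u x) (multiple3 (\<lambda>i. form2 (T i)) x))
    = (\<Sum>i\<in>UNIV. lin (\<lambda>j. u (Inl (i, j))) * form2 (T i)) + (\<Sum>i\<in>UNIV. form2 (T i) * lin (\<lambda>j. u (Inr (i, j))))"
proof -
  have "(\<Sum>x\<in>UNIV. F x) = (\<Sum>i\<in>UNIV. \<Sum>j\<in>UNIV. F (Inl (i, j))) + (\<Sum>i\<in>UNIV. \<Sum>j\<in>UNIV. F (Inr (i, j)))"
    for F :: "(gen3 \<times> gen3) + (gen3 \<times> gen3) \<Rightarrow> 'a free3"
    by (simp add: UNIV_Plus_UNIV[symmetric] sum.Plus UNIV_Times_UNIV[symmetric] sum.cartesian_product
        del: UNIV_Plus_UNIV UNIV_Times_UNIV)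
  then show ?thesis
    by (simp add: multiple3_def lin_def sum_distrib_left sum_distrib_right)
qed

lemma card_multiples: "card (UNIV :: ((gen3 \<times> gen3) + (gen3 \<times> gen3)) set) = 18"
proof -
  have "card (UNIV :: (gen3 \<times> gen3) set) = 9"
    using card_cartesian_product[of "UNIV :: gen3 set" "UNIV :: gen3 set"] by (simp add: card_UNIV_gen3)
  then show ?thesis
    using card_Plus[of "UNIV :: (gen3 \<times> gen3) set" "UNIV :: (gen3 \<times> gen3) set"] by simp
qed

text \<open>The eighteen products are independent in the component of dimension twenty-seven.\<close>

lemma qdim_3_if_no_syzygy:
  fixes T :: "gen3 \<Rightarrow> gen3 \<Rightarrow> gen3 \<Rightarrow> 'k::field"
  assumes none: "\<And>P Q i j. (\<And>j k h. (\<Sum>i\<in>UNIV. P i j * T i k h) + (\<Sum>i\<in>UNIV. T i j k * Q i h) = 0)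
      \<Longrightarrow> P i j = 0 \<and> Q i j = 0"
  shows "quadratic_relations.qdim (\<lambda>i. form2 (T i)) 3 = 9"
proof -
  interpret quadratic_relations "\<lambda>i. form2 (T i)" by standard (rule form2_hom_part)
  have "fv.dim (I 3) = card (UNIV :: ((gen3 \<times> gen3) + (gen3 \<times> gen3)) set)"
    unfolding I_span relation_multiples_3
  proof (rule fv.dim_family_independent)
    fix u :: "(gen3 \<times> gen3) + (gen3 \<times> gen3) \<Rightarrow> 'k"
    let ?P = "\<lambda>i j. u (Inl (i, j))" and ?Q = "\<lambda>i j. u (Inr (i, j))"
    assume "(\<Sum>x\<in>UNIV. smul (u x) (multiple3 (\<lambda>i. form2 (T i)) x)) = 0"
    then have *: "(\<Sum>i\<in>UNIV. lin (?P i) * form2 (T i)) + (\<Sum>i\<in>UNIV. form2 (T i) * lin (?Q i)) = 0"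
      by (simp only: sum_multiple3)
    have "(\<Sum>i\<in>UNIV. ?P i j * T i k h) + (\<Sum>i\<in>UNIV. T i j k * ?Q i h) = 0" for j k h
      using arg_cong[OF *, of "\<lambda>f. Poly_Mapping.lookup f [j, k, h]"]
      by (simp add: lookup_add lookup_sum lookup_degree_three)
    then have z: "?P i j = 0 \<and> ?Q i j = 0" for i j by (rule none)
    show "\<forall>x\<in>UNIV. u x = 0"
    proof
      fix x show "u x = 0" using z by (cases x) auto
    qed
  qed simp
  then show ?thesis using qdim_eq[of 3] by (simp add: card_multiples)
qed

text \<open>This lemma and the next two treat a relation among the eighteen products of variables and relations,
  one degree modulo three at a time: \<open>p\<close> and \<open>q\<close> are the coefficients of the three products on either side, and
  each equation is the coefficient of one word.\<close>

lemma syzygy_degree_0: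
  fixes a :: "'k::field"
  assumes nz: "\<alpha> \<noteq> 0" "\<beta> \<noteq> 0" "\<gamma> \<noteq> 0" and p: "p1 \<noteq> 0 \<or> p2 \<noteq> 0 \<or> p3 \<noteq> 0 \<or> q1 \<noteq> 0 \<or> q2 \<noteq> 0 \<or> q3 \<noteq> 0"
    and eq: "- (p1 * \<alpha>) = \<alpha> * q1" "- (p2 * \<beta>) = \<beta> * q2" "- (p3 * \<gamma>) = \<gamma> * q3"
      "p1 + q3 = 0" "p2 + q1 = 0" "p3 + q2 = 0"
      "p1 * - a + - b * q2 = 0" "p2 * - b + - c * q3 = 0" "p3 * - c + - a * q1 = 0"
  shows "a = b \<and> b = c"
proof -
  have "\<alpha> * q1 = \<alpha> * (- p1)" "\<beta> * q2 = \<beta> * (- p2)" "\<gamma> * q3 = \<gamma> * (- p3)"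
    by (simp_all add: mult.commute flip: eq(1-3))
  then have q: "q1 = - p1" "q2 = - p2" "q3 = - p3"
    unfolding mult_left_cancel[OF nz(1)] mult_left_cancel[OF nz(2)] mult_left_cancel[OF nz(3)] by blast+
  have "p2 = p1" "p3 = p1" using eq(4,5) unfolding q by simp_all
  then show ?thesis using eq(7-9) p unfolding q by simp
qed

text \<open>The \<open>p\<close> determine the \<open>q\<close> and, going round the cycle \<open>p1\<close>, \<open>p2\<close>, \<open>p3\<close>, each other, so that none of them
  vanishes; going round once gives the last equation.\<close>

lemma syzygy_degree_1:
  fixes a :: "'k::field"
  assumes nz: "\<alpha> \<noteq> 0" "\<beta> \<noteq> 0" "\<gamma> \<noteq> 0" and p: "p1 \<noteq> 0 \<or> p2 \<noteq> 0 \<or> p3 \<noteq> 0 \<or> q1 \<noteq> 0 \<or> q2 \<noteq> 0 \<or> q3 \<noteq> 0"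
    and eq': "p1 + - \<alpha> * q2 = 0" "p1 * - c + q1 = 0" "p1 * - \<gamma> + - b * q3 = 0"
      "p2 + - \<beta> * q3 = 0" "p2 * - a + q2 = 0" "p2 * - \<alpha> + - c * q1 = 0"
      "p3 + - \<gamma> * q1 = 0" "p3 * - b + q3 = 0" "p3 * - \<beta> + - a * q2 = 0"
  shows "a\<^sup>2 * b = -1 \<and> b\<^sup>2 * c = -1 \<and> c\<^sup>2 * a = -1 \<and> a * b * c * (\<alpha> * \<beta> * \<gamma>) = 1"
proof -
  have eq1: "p1 = \<alpha> * q2" using eq'(1) by (simp add: add_eq_0_iff2 mult.commute)
  have eq2: "q1 = c * p1" using eq'(2) by (simp add: add_eq_0_iff mult.commute)
  have eq3: "\<gamma> * p1 = - b * q3" using eq'(3) by (simp add: add_eq_0_iff mult.commute) (metis minus_minus)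
  have eq4: "p2 = \<beta> * q3" using eq'(4) by (simp add: add_eq_0_iff2 mult.commute)
  have eq5: "q2 = a * p2" using eq'(5) by (simp add: add_eq_0_iff mult.commute)
  have eq6: "\<alpha> * p2 = - c * q1" using eq'(6) by (simp add: add_eq_0_iff mult.commute) (metis minus_minus)
  have eq7: "p3 = \<gamma> * q1" using eq'(7) by (simp add: add_eq_0_iff2 mult.commute)
  have eq8: "q3 = b * p3" using eq'(8) by (simp add: add_eq_0_iff mult.commute)
  have eq9: "\<beta> * p3 = - a * q2" using eq'(9) by (simp add: add_eq_0_iff mult.commute) (metis minus_minus)
  note eq = eq1 eq2 eq3 eq4 eq5 eq6 eq7 eq8 eq9
  have p1: "p1 = \<alpha> * a * p2" using eq(1) unfolding eq(5) by (simp only: mult.assoc)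
  have p2: "p2 = \<beta> * b * p3" using eq(4) unfolding eq(8) by (simp only: mult.assoc)
  have p3: "p3 = \<gamma> * c * p1" using eq(7) unfolding eq(2) by (simp only: mult.assoc)
  have ne1: "p1 \<noteq> 0"
  proof
    assume 0: "p1 = 0"
    then have "p3 = 0" using p3 by simp
    moreover from this have "p2 = 0" using p2 by simp
    moreover have "q1 = 0" "q2 = 0" "q3 = 0" using eq(2,5,8) 0 calculation by auto
    ultimately show False using p 0 by blast
  qed
  moreover from this have "p2 \<noteq> 0" using p1 by auto
  moreover from this have "p3 \<noteq> 0" using p2 by auto
  ultimately have ne: "p1 \<noteq> 0" "p2 \<noteq> 0" "p3 \<noteq> 0" by blast+
  have "\<alpha> * a * (\<beta> * b * p3) = p1" by (simp only: p1 p2)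
  then have "\<alpha> * a * (\<beta> * b * (\<gamma> * c * p1)) = p1" unfolding p3 .
  then have "p1 * (a * b * c * (\<alpha> * \<beta> * \<gamma>)) = p1" by (simp add: mult_ac)
  then have 1: "a * b * c * (\<alpha> * \<beta> * \<gamma>) = 1" using ne by simp
  have e: "\<gamma> * p1 = - b * (b * (\<gamma> * c * p1))" "\<alpha> * p2 = - c * (c * (\<alpha> * a * p2))"
    "\<beta> * p3 = - a * (a * (\<beta> * b * p3))"
    by (rule eq(3)[unfolded eq(8) p3], rule eq(6)[unfolded eq(2) p1], rule eq(9)[unfolded eq(5) p2])
  have "\<gamma> * p1 * (b\<^sup>2 * c + 1) = \<gamma> * p1 - (- b * (b * (\<gamma> * c * p1)))"
    "\<alpha> * p2 * (c\<^sup>2 * a + 1) = \<alpha> * p2 - (- c * (c * (\<alpha> * a * p2)))"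
    "\<beta> * p3 * (a\<^sup>2 * b + 1) = \<beta> * p3 - (- a * (a * (\<beta> * b * p3)))"
    by (simp_all add: algebra_simps power2_eq_square)
  then have "\<gamma> * p1 * (b\<^sup>2 * c + 1) = 0" "\<alpha> * p2 * (c\<^sup>2 * a + 1) = 0" "\<beta> * p3 * (a\<^sup>2 * b + 1) = 0"
    using e by (simp_all only: diff_self)
  then have "a\<^sup>2 * b + 1 = 0" "b\<^sup>2 * c + 1 = 0" "c\<^sup>2 * a + 1 = 0" using ne nz by simp_all
  then show ?thesis using 1 by (simp add: eq_neg_iff_add_eq_0)
qed

text \<open>Reversing all words and exchanging \<open>x\<close> with \<open>y\<close> preserves the form of the relations, with \<open>a\<close>, \<open>b\<close> and
  \<open>\<alpha>\<close>, \<open>\<beta>\<close> exchanged. It exchanges left and right products and takes this system to the one in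
  degree \<open>1\<close>.\<close>

lemma syzygy_degree_2:
  fixes a :: "'k::field"
  assumes nz: "\<alpha> \<noteq> 0" "\<beta> \<noteq> 0" "\<gamma> \<noteq> 0" and p: "p1 \<noteq> 0 \<or> p2 \<noteq> 0 \<or> p3 \<noteq> 0 \<or> q1 \<noteq> 0 \<or> q2 \<noteq> 0 \<or> q3 \<noteq> 0"
    and eq: "p1 + - b * q1 = 0" "p1 * - b + - \<alpha> * q3 = 0" "p1 * - \<beta> + q2 = 0"
      "p2 + - c * q2 = 0" "p2 * - c + - \<beta> * q1 = 0" "p2 * - \<gamma> + q3 = 0"
      "p3 + - a * q3 = 0" "p3 * - a + - \<gamma> * q2 = 0" "p3 * - \<alpha> + q1 = 0"
  shows "b\<^sup>2 * a = -1 \<and> a\<^sup>2 * c = -1 \<and> c\<^sup>2 * b = -1 \<and> b * a * c * (\<beta> * \<alpha> * \<gamma>) = 1"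
proof (rule syzygy_degree_1)
  show "q2 \<noteq> 0 \<or> q1 \<noteq> 0 \<or> q3 \<noteq> 0 \<or> p2 \<noteq> 0 \<or> p1 \<noteq> 0 \<or> p3 \<noteq> 0" using p by blast
  show "q2 + - \<beta> * p1 = 0" using eq(3) by (simp add: add_ac mult.commute)
  show "q2 * - c + p2 = 0" using eq(4) by (simp add: add_ac mult.commute)
  show "q2 * - \<gamma> + - a * p3 = 0" using eq(8) by (simp add: add_ac mult.commute)
  show "q1 + - \<alpha> * p3 = 0" using eq(9) by (simp add: add_ac mult.commute)
  show "q1 * - b + p1 = 0" using eq(1) by (simp add: add_ac mult.commute)
  show "q1 * - \<beta> + - c * p2 = 0" using eq(5) by (simp add: add_ac mult.commute)
  show "q3 + - \<gamma> * p2 = 0" using eq(6) by (simp add: add_ac mult.commute)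
  show "q3 * - a + p3 = 0" using eq(7) by (simp add: add_ac mult.commute)
  show "q3 * - \<alpha> + - b * p1 = 0" using eq(2) by (simp add: add_ac mult.commute)
qed (use nz in simp_all)

text \<open>Without superpotential the eighteen products would be independent and the dimension would be
  \<open>9\<close>.\<close>

lemma superpotential_condition_necessary:
  fixes a b c \<alpha> \<beta> \<gamma> :: "'k::field"
  assumes nz: "\<alpha> * \<beta> * \<gamma> \<noteq> 0"
    and dim: "quadratic_relations.qdim (\<lambda>i. form2 (sklyanin a b c \<alpha> \<beta> \<gamma> i)) 3 = 10"
  shows "superpotential_condition a b c \<alpha> \<beta> \<gamma>"
proof (rule ccontr)
  assume neg: "\<not> superpotential_condition a b c \<alpha> \<beta> \<gamma>"
  have nz': "\<alpha> \<noteq> 0" "\<beta> \<noteq> 0" "\<gamma> \<noteq> 0" using nz by auto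
  have "quadratic_relations.qdim (\<lambda>i. form2 (sklyanin a b c \<alpha> \<beta> \<gamma> i)) 3 = 9"
  proof (rule qdim_3_if_no_syzygy)
    fix P Q :: "gen3 \<Rightarrow> gen3 \<Rightarrow> 'k" and i j :: gen3
    assume *: "(\<Sum>i\<in>UNIV. P i j * sklyanin a b c \<alpha> \<beta> \<gamma> i k h) + (\<Sum>i\<in>UNIV. sklyanin a b c \<alpha> \<beta> \<gamma> i j k * Q i h) = 0" for j k h
    note c = *[unfolded sum_gen3 sklyanin_def, simplified]
    have 0: "P GX GX = 0 \<and> P GY GY = 0 \<and> P GZ GZ = 0 \<and> Q GX GX = 0 \<and> Q GY GY = 0 \<and> Q GZ GZ = 0"
    proof (rule ccontr)
      assume "\<not> ?thesis"
      then have n: "P GX GX \<noteq> 0 \<or> P GY GY \<noteq> 0 \<or> P GZ GZ \<noteq> 0 \<or> Q GX GX \<noteq> 0 \<or> Q GY GY \<noteq> 0 \<or> Q GZ GZ \<noteq> 0" by blast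
      have "a = b \<and> b = c"
      proof (rule syzygy_degree_0[OF nz' n])
        show "- (P GX GX * \<alpha>) = \<alpha> * Q GX GX" "- (P GY GY * \<beta>) = \<beta> * Q GY GY" "- (P GZ GZ * \<gamma>) = \<gamma> * Q GZ GZ"
          "P GX GX + Q GZ GZ = 0" "P GY GY + Q GX GX = 0" "P GZ GZ + Q GY GY = 0"
          "P GX GX * - a + - b * Q GY GY = 0" "P GY GY * - b + - c * Q GZ GZ = 0" "P GZ GZ * - c + - a * Q GX GX = 0"
          using c[of GX GX GX] c[of GY GY GY] c[of GZ GZ GZ]
            c[of GX GY GZ] c[of GY GZ GX] c[of GZ GX GY]
            c[of GX GZ GY] c[of GY GX GZ] c[of GZ GY GX]
          by simp_all
      qed
      then show False using neg by (simp add: superpotential_condition_def)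
    qed
    have 1: "P GZ GX = 0 \<and> P GX GY = 0 \<and> P GY GZ = 0 \<and> Q GZ GX = 0 \<and> Q GX GY = 0 \<and> Q GY GZ = 0"
    proof (rule ccontr)
      assume "\<not> ?thesis"
      then have n: "P GZ GX \<noteq> 0 \<or> P GX GY \<noteq> 0 \<or> P GY GZ \<noteq> 0 \<or> Q GZ GX \<noteq> 0 \<or> Q GX GY \<noteq> 0 \<or> Q GY GZ \<noteq> 0" by blast
      have "a\<^sup>2 * b = -1 \<and> b\<^sup>2 * c = -1 \<and> c\<^sup>2 * a = -1 \<and> a * b * c * (\<alpha> * \<beta> * \<gamma>) = 1"
      proof (rule syzygy_degree_1[OF nz' n])
        show "P GZ GX + - \<alpha> * Q GX GY = 0" "P GZ GX * - c + Q GZ GX = 0" "P GZ GX * - \<gamma> + - b * Q GY GZ = 0"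
          "P GX GY + - \<beta> * Q GY GZ = 0" "P GX GY * - a + Q GX GY = 0" "P GX GY * - \<alpha> + - c * Q GZ GX = 0"
          "P GY GZ + - \<gamma> * Q GZ GX = 0" "P GY GZ * - b + Q GY GZ = 0" "P GY GZ * - \<beta> + - a * Q GX GY = 0"
          using c[of GX GX GY] c[of GX GY GX] c[of GX GZ GZ]
            c[of GY GY GZ] c[of GY GZ GY] c[of GY GX GX]
            c[of GZ GZ GX] c[of GZ GX GZ] c[of GZ GY GY]
          by simp_all
      qed
      then show False using neg by (simp add: superpotential_condition_def)
    qed
    have 2: "P GY GX = 0 \<and> P GZ GY = 0 \<and> P GX GZ = 0 \<and> Q GY GX = 0 \<and> Q GZ GY = 0 \<and> Q GX GZ = 0"
    proof (rule ccontr)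
      assume "\<not> ?thesis"
      then have n: "P GY GX \<noteq> 0 \<or> P GZ GY \<noteq> 0 \<or> P GX GZ \<noteq> 0 \<or> Q GY GX \<noteq> 0 \<or> Q GZ GY \<noteq> 0 \<or> Q GX GZ \<noteq> 0" by blast
      have "b\<^sup>2 * a = -1 \<and> a\<^sup>2 * c = -1 \<and> c\<^sup>2 * b = -1 \<and> b * a * c * (\<beta> * \<alpha> * \<gamma>) = 1"
      proof (rule syzygy_degree_2[OF nz' n])
        show "P GY GX + - b * Q GY GX = 0" "P GY GX * - b + - \<alpha> * Q GX GZ = 0" "P GY GX * - \<beta> + Q GZ GY = 0"
          "P GZ GY + - c * Q GZ GY = 0" "P GZ GY * - c + - \<beta> * Q GY GX = 0" "P GZ GY * - \<gamma> + Q GX GZ = 0"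
          "P GX GZ + - a * Q GX GZ = 0" "P GX GZ * - a + - \<gamma> * Q GZ GY = 0" "P GX GZ * - \<alpha> + Q GY GX = 0"
          using c[of GX GZ GX] c[of GX GX GZ] c[of GX GY GY]
            c[of GY GX GY] c[of GY GY GX] c[of GY GZ GZ]
            c[of GZ GY GZ] c[of GZ GZ GY] c[of GZ GX GX]
          by simp_all
      qed
      then show False using neg by (simp add: superpotential_condition_def mult_ac)
    qed
    show "P i j = 0 \<and> Q i j = 0" using 0 1 2 by (cases i; cases j) auto
  qed
  then show False using dim by simp
qed

lemma lin_uminus: "lin (\<lambda>j. - c j) = - lin c"
  by (simp add: lin_def sum_negf)

lemma relation_from_overlap:
  assumes "\<forall>j k h. (\<Sum>i\<in>UNIV. T i j k * l i h) = (\<Sum>i\<in>UNIV. m i j * T i k h)"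
  shows "(\<Sum>x\<in>UNIV. smul (case_sum (\<lambda>(i, j). m i j) (\<lambda>(i, j). - l i j) x)
    (multiple3 (\<lambda>i. form2 (T i)) x)) = 0"
  using assms unfolding overlap_iff[symmetric] sum_multiple3
  by (simp add: lin_uminus sum_negf)

text \<open>Applied with \<open>D\<close> a set of two indices, to two relations each of which involves only one of them,
  this removes both members from a spanning family.\<close>

lemma span_if_relation:
  assumes rel: "(\<Sum>x\<in>UNIV. smul (u x) (h x)) = (0 :: 'k::field free3)" and x0: "u x0 \<noteq> 0"
    and D: "\<And>x. x \<in> D \<Longrightarrow> x \<noteq> x0 \<Longrightarrow> u x = 0"
  shows "h (x0 :: 'x::finite) \<in> fv.span (h ` (UNIV - D))"
proof -
  have "smul (u x0) (h x0) + (\<Sum>x\<in>UNIV - {x0}. smul (u x) (h x)) = 0"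
    using rel by (subst (asm) sum.remove[of _ x0]) auto
  then have "smul (u x0) (h x0) = - (\<Sum>x\<in>UNIV - {x0}. smul (u x) (h x))"
    by (simp add: eq_neg_iff_add_eq_0)
  moreover have "smul (u x) (h x) \<in> fv.span (h ` (UNIV - D))" if "x \<noteq> x0" for x
    using D[OF _ that] by (cases "x \<in> D") (auto simp: fv.span_zero intro: fv.span_scale fv.span_base)
  ultimately have "smul (u x0) (h x0) \<in> fv.span (h ` (UNIV - D))"
    by (auto intro!: fv.span_neg fv.span_sum)
  then have "smul (inverse (u x0)) (smul (u x0) (h x0)) \<in> fv.span (h ` (UNIV - D))"
    by (rule fv.span_scale)
  then show ?thesis using x0 by simp
qed

text \<open>There are superpotentials both of degree \<open>0\<close> and of degree \<open>1\<close>, so at most sixteen of the eighteen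
  products are independent.\<close>

lemma degenerate_qdim_3:
  fixes a :: "'k::field"
  assumes "a * a * a = -1" "\<alpha> * \<beta> * \<gamma> = -1"
  shows "11 \<le> quadratic_relations.qdim (\<lambda>i. form2 (sklyanin a a a \<alpha> \<beta> \<gamma> i)) 3"
proof -
  let ?T = "sklyanin a a a \<alpha> \<beta> \<gamma>"
  let ?h = "multiple3 (\<lambda>i. form2 (?T i))" and ?D = "{Inr (GX, GX), Inr (GZ, GX)} :: ((gen3 \<times> gen3) + (gen3 \<times> gen3)) set"
  interpret quadratic_relations "\<lambda>i. form2 (?T i)" by (rule sklyanin_quadratic)
  have nz: "\<alpha> * \<beta> * \<gamma> \<noteq> 0" "a \<noteq> 0" using assms by auto
  have "\<forall>j k h. (\<Sum>i\<in>UNIV. ?T i j k * (if h = i then 1 else 0)) = (\<Sum>i\<in>UNIV. (if j = i then 1 else 0) * ?T i k h)"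
    by (intro allI cubic_overlap_degree_0 refl)
  from relation_from_overlap[OF this] have "?h (Inr (GX, GX)) \<in> fv.span (?h ` (UNIV - ?D))"
    by (rule span_if_relation) auto
  moreover have "\<forall>j k h. (\<Sum>i\<in>UNIV. ?T i j k
        * case_gen3 (case_gen3 0 (- 1 / \<alpha>) 0) (case_gen3 0 0 (\<gamma> / a)) (case_gen3 (- a) 0 0) i h)
      = (\<Sum>i\<in>UNIV. case_gen3 (case_gen3 0 (1 / (a * \<alpha>)) 0) (case_gen3 0 0 (\<gamma> * a)) (case_gen3 1 0 0) i j * ?T i k h)"
    by (intro allI cubic_overlap_degree_1) (use assms in \<open>simp_all add: power2_eq_square\<close>)
  from relation_from_overlap[OF this] have "?h (Inr (GZ, GX)) \<in> fv.span (?h ` (UNIV - ?D))"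
    by (rule span_if_relation) (use nz in auto)
  ultimately have "range ?h \<subseteq> fv.span (?h ` (UNIV - ?D))"
    by (auto intro: fv.span_base)
  then have "fv.dim (I 3) \<le> card (?h ` (UNIV - ?D))"
    unfolding I_span relation_multiples_3
    by (intro fv.dim_le_card fv.span_minimal) auto
  also have "\<dots> \<le> card (UNIV - ?D)" by (rule card_image_le) simp
  also have "\<dots> = 16" by (simp add: card_Diff_subset card_multiples)
  finally show ?thesis using qdim_eq[of 3] by simp
qed

section \<open>The classification\<close>

text \<open>If \<open>a\<^sup>2 b = b\<^sup>2 c = c\<^sup>2 a = -1\<close>, then \<open>c = - a\<^sup>4\<close> by the first two equations, so \<open>a\<^sup>9 = -1\<close> by the third
  and \<open>b\<close>, \<open>c\<close>, \<open>\<alpha> \<beta> \<gamma>\<close> are powers of \<open>a\<close> up to sign. In this case \<open>a b c = a\<^sup>3\<close>, and \<open>a\<^sup>3 = -1\<close> already implies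
  \<open>\<alpha> \<beta> \<gamma> = -1\<close>. The third alternative of \<open>superpotential_condition\<close> exchanges \<open>b\<close> and \<open>c\<close>.\<close>

lemma condition_iff:
  fixes a b c p :: "'k::field"
  assumes "p = \<alpha> * \<beta> * \<gamma>"
  shows "(a = b \<and> b = c \<and> (a ^ 3, p) \<noteq> (-1, -1)) \<or>
      (a ^ 9 = -1 \<and> a ^ 3 \<noteq> -1 \<and> {b, c} = {a ^ 7, a ^ 13} \<and> p = - (a ^ 6))
    \<longleftrightarrow> superpotential_condition a b c \<alpha> \<beta> \<gamma> \<and> \<not> (a * b * c = -1 \<and> p = -1)"
    (is "?L1 \<or> ?L2 \<longleftrightarrow> ?R")
proof -
  have powers: "a\<^sup>2 * a ^ 7 = a ^ 9" "(a ^ 7)\<^sup>2 * a ^ 13 = (a ^ 9) ^ 3" "(a ^ 13)\<^sup>2 * a = (a ^ 9) ^ 3"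
    "a * a ^ 7 * a ^ 13 = (a ^ 9)\<^sup>2 * a ^ 3" "a ^ 3 * a ^ 6 = a ^ 9"
    by (simp_all flip: power_mult power_add power_Suc power_Suc2)
  have solve: "a ^ 9 = -1 \<and> b = a ^ 7 \<and> c = a ^ 13 \<and> p = - (a ^ 6)"
    if h: "a\<^sup>2 * b = -1" "b\<^sup>2 * c = -1" "c\<^sup>2 * a = -1" "a * b * c * p = 1" for b c
  proof -
    have "(a\<^sup>2 * b)\<^sup>2 * c = b\<^sup>2 * c * a ^ 4" by (simp add: power_mult_distrib mult_ac flip: power_mult)
    then have c: "c = - (a ^ 4)" using h(1,2) by simp
    then have 9: "a ^ 9 = -1" using h(3) by (simp flip: power_mult power_Suc2)
    have "a\<^sup>2 \<noteq> 0" using h(1) by auto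
    moreover have "a\<^sup>2 * b = a\<^sup>2 * a ^ 7" unfolding powers(1) h(1) 9 ..
    ultimately have b: "b = a ^ 7" by (rule mult_left_cancel[THEN iffD1])
    have "a ^ 13 = a ^ 9 * a ^ 4" by (simp flip: power_add)
    also have "\<dots> = - (a ^ 4)" unfolding 9 by simp
    finally have c13: "c = a ^ 13" using c by simp
    have "a ^ 3 * p = 1" using h(4) powers(4) 9 unfolding b c13 by simp
    then have "a ^ 6 * (a ^ 3 * p) = a ^ 6" by simp
    then have "a ^ 9 * p = a ^ 6" using powers(5) by (simp add: mult_ac flip: mult.assoc)
    then have "p = - (a ^ 6)" unfolding 9 by (metis minus_minus mult_minus1)
    with 9 b c13 show ?thesis by blast
  qed
  have check: "a\<^sup>2 * b = -1 \<and> b\<^sup>2 * c = -1 \<and> c\<^sup>2 * a = -1 \<and> a * b * c * p = 1 \<and> a * b * c = a ^ 3"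
    if h: "a ^ 9 = -1" "b = a ^ 7" "c = a ^ 13" "p = - (a ^ 6)" for b c
  proof -
    have "a * b * c = a ^ 3" using powers(4) by (simp add: h)
    moreover have "a ^ 3 * p = 1" using powers(5) by (simp add: h)
    ultimately show ?thesis using powers(1-3) by (simp add: h)
  qed
  have nondeg: "a ^ 3 \<noteq> -1" if h: "a ^ 9 = -1" "p = - (a ^ 6)" "\<not> (a ^ 3 = -1 \<and> p = -1)"
  proof
    assume 3: "a ^ 3 = -1"
    have "a ^ 6 = (a ^ 3)\<^sup>2" by (simp flip: power_mult)
    also have "\<dots> = 1" unfolding 3 by simp
    finally show False using h(2,3) 3 by simp
  qed
  show ?thesis
  proof
    assume "?L1 \<or> ?L2"
    then show ?R
    proof
      assume ?L1
      then show ?R by (auto simp: superpotential_condition_def power3_eq_cube)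
    next
      assume L: ?L2
      then consider "b = a ^ 7" "c = a ^ 13" | "b = a ^ 13" "c = a ^ 7" by (auto simp: doubleton_eq_iff)
      then show ?R
      proof cases
        case 1
        with L check[of b c] show ?thesis by (simp add: superpotential_condition_def assms)
      next
        case 2
        with L check[of c b] show ?thesis by (simp add: superpotential_condition_def assms mult_ac)
      qed
    qed
  next
    assume R: ?R
    then consider "a = b" "b = c"
      | "a\<^sup>2 * b = -1" "b\<^sup>2 * c = -1" "c\<^sup>2 * a = -1" "a * b * c * p = 1"
      | "a\<^sup>2 * c = -1" "c\<^sup>2 * b = -1" "b\<^sup>2 * a = -1" "a * c * b * p = 1"
      unfolding superpotential_condition_def assms by (auto simp: mult_ac)
    then show "?L1 \<or> ?L2"
    proof cases
      case 1
      then show ?thesis using R by (simp add: power3_eq_cube)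
    next
      case 2
      note s = solve[OF 2]
      then have "a * b * c = a ^ 3" using check[of b c] by blast
      then have "a ^ 3 \<noteq> -1" using nondeg s R by simp
      then show ?thesis using s by simp
    next
      case 3
      note s = solve[OF 3]
      then have "a * c * b = a ^ 3" using check[of c b] by blast
      then have "a ^ 3 \<noteq> -1" using nondeg s R by (simp add: mult_ac)
      then show ?thesis using s by (simp add: insert_commute)
    qed
  qed
qed

theorem corollary1p5:
  fixes a b c \<alpha> \<beta> \<gamma> :: "'k::field"
  assumes "\<alpha> * \<beta> * \<gamma> \<noteq> 0"
  shows "PHS (S_rels a b c \<alpha> \<beta> \<gamma>) \<longleftrightarrow>
    (a = b \<and> b = c \<and> (a ^ 3, \<alpha> * \<beta> * \<gamma>) \<noteq> (-1, -1)) \<or>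
    (a ^ 9 = -1 \<and> a ^ 3 \<noteq> -1 \<and> {b, c} = {a ^ 7, a ^ 13} \<and> \<alpha> * \<beta> * \<gamma> = - (a ^ 6))"
  unfolding S_rels_eq_range PHS_iff_dims[OF sklyanin_quadratic] condition_iff[OF refl]
proof (intro iffI allI)
  let ?d = "quadratic_relations.qdim (\<lambda>i. form2 (sklyanin a b c \<alpha> \<beta> \<gamma> i))"
  assume "\<forall>n. ?d n = (n + 2) choose 2"
  then have "?d 3 = (3 + 2) choose 2" by (rule spec)
  then have a3: "?d 3 = 10" by (simp add: choose_two)
  then have sp: "superpotential_condition a b c \<alpha> \<beta> \<gamma>"
    by (rule superpotential_condition_necessary[OF assms])
  moreover have "\<not> (a * b * c = -1 \<and> \<alpha> * \<beta> * \<gamma> = -1)"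
  proof
    assume d: "a * b * c = -1 \<and> \<alpha> * \<beta> * \<gamma> = -1"
    then have nz: "a \<noteq> 0" "b \<noteq> 0" "c \<noteq> 0" by auto
    \<comment> \<open>The other alternatives then say \<open>a\<^sup>2 b = a b c\<close> and so on, which makes the parameters equal too.\<close>
    have "a = b \<and> b = c"
    proof (rule ccontr)
      assume "\<not> (a = b \<and> b = c)"
      then have "a\<^sup>2 * b = a * b * c \<and> b\<^sup>2 * c = a * b * c \<or> a\<^sup>2 * c = a * b * c \<and> b\<^sup>2 * a = a * b * c"
        using sp d by (auto simp: superpotential_condition_def)
      then have "a = c \<and> b = a \<or> a = b \<and> b = c"
        using nz by (auto simp: power2_eq_square)
      then show False using \<open>\<not> (a = b \<and> b = c)\<close> by auto
    qed
    then show False using a3 degenerate_qdim_3[of a \<alpha> \<beta> \<gamma>] d by simp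
  qed
  ultimately show "superpotential_condition a b c \<alpha> \<beta> \<gamma> \<and> \<not> (a * b * c = -1 \<and> \<alpha> * \<beta> * \<gamma> = -1)" ..
next
  fix n
  assume "superpotential_condition a b c \<alpha> \<beta> \<gamma> \<and> \<not> (a * b * c = -1 \<and> \<alpha> * \<beta> * \<gamma> = -1)"
  then show "quadratic_relations.qdim (\<lambda>i. form2 (sklyanin a b c \<alpha> \<beta> \<gamma> i)) n = (n + 2) choose 2"
    using sklyanin_dims_field[OF assms] by blast
qed

end
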